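(* Let $\mathcal C$ be a closed symmetric monoidal category and $\mathcal M$ a left $\mathcal C$-actegory satisfying the standing assumptions in the context. Let $\alpha:(a,\mu_a,\iota_a)\to(b,\mu_b,\iota_b)$ be a morphism in $Comm(\mathcal C)$. Then the assignment $(m,\rho)\mapsto(b\boxtimes_a m,\widetilde\rho)$ extends to a functor $\alpha^*:\mathbf{Mod}_{\mathcal M}(a)\to\mathbf{Mod}_{\mathcal M}(b)$ which is left adjoint to the restriction of scalars $\alpha_*:\mathbf{Mod}_{\mathcal M}(b)\to\mathbf{Mod}_{\mathcal M}(a)$.
   Context: $(\mathcal C,\otimes,1)$ is a closed symmetric monoidal category which is complete and cocomplete. A left $\mathcal C$-actegory $(\mathcal M,\boxtimes,\lambda,l)$ is a category $\mathcal M$ with a bifunctor $\boxtimes:\mathcal C\times\mathcal M\to\mathcal M$ and natural isomorphisms $\lambda_{a,b,m}:a\boxtimes(b\boxtimes m)\to(a\otimes b)\boxtimes m$ and $l_m:1\boxtimes m\to m$ satisfying the usual pentagon and unit coherence axioms (as for a module category over a monoidal category). $\mathcal M$ is a fixed left $\mathcal C$-actegory whose underlying category is complete and cocomplete and such that for all $a\in\mathcal C$, $m\in\mathcal M$ the functors $a\boxtimes -:\mathcal M\to\mathcal M$ and $-\boxtimes m:\mathcal C\to\mathcal M$ preserve colimits. $Comm(\mathcal C)$ is the category of commutative monoid objects in $\mathcal C$. For $a=(a,\mu_a,\iota_a)\in Comm(\mathcal C)$, $\mathbf{Mod}_{\mathcal M}(a)$ is the category of left $a$-modules in $\mathcal M$: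 objects are pairs $(m,\rho)$ with $m\in\mathcal M$ and $\rho:a\boxtimes m\to m$ such that $\rho\circ(\mu_a\boxtimes 1_m)\circ\lambda_{a,a,m}=\rho\circ(1_a\boxtimes\rho)$ and $\rho\circ(\iota_a\boxtimes 1_m)=l_m$; morphisms $(m,\rho)\to(m',\rho')$ are morphisms $\psi:m\to m'$ with $\rho'\circ(1_a\boxtimes\psi)=\psi\circ\rho$. The restriction of scalars along $\alpha:a\to b$ is $\alpha_*(n,\tau)=(n,\tau\circ(\alpha\boxtimes 1_n))$. For $(m,\rho)\in\mathbf{Mod}_{\mathcal M}(a)$, $b\boxtimes_a m$ is the coequalizer in $\mathcal M$ of the two morphisms $b\boxtimes(a\boxtimes m)\rightrightarrows b\boxtimes m$ given by $1_b\boxtimes\rho$ and $\big((\mu_b\circ(1_b\otimes\alpha))\boxtimes 1_m\big)\circ\lambda_{b,a,m}$, with canonical morphism $coeq:b\boxtimes m\to b\boxtimes_a m$. The morphism $\widetilde\rho:b\boxtimes(b\boxtimes_a m)\to b\boxtimes_a m$ is the $b$-module structure uniquely determined by $\widetilde\rho\circ(1_b\boxtimes coeq)=coeq\circ(\mu_b\boxtimes 1_m)\circ\lambda_{b,b,m}$. *)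

theory Defs
  imports "HOL-Library.Equipollence"
begin

section \<open>Categories and functors\<close>

record ('o, 'a) cat =
  Obj :: "'o set"
  Arr :: "'a set"
  Dom :: "'a \<Rightarrow> 'o"
  Cod :: "'a \<Rightarrow> 'o"
  Idn :: "'o \<Rightarrow> 'a"
  Cmp :: "'a \<Rightarrow> 'a \<Rightarrow> 'a" (infixr \<open>\<cdot>\<index>\<close> 55)

definition hom :: "('o, 'a, 'z) cat_scheme \<Rightarrow> 'o \<Rightarrow> 'o \<Rightarrow> 'a set" where
  "hom C x y = {f \<in> Arr C. Dom C f = x \<and> Cod C f = y}"

locale category =
  fixes C :: "('o, 'a, 'z) cat_scheme" (structure)
  assumes Dom_in_Obj: "f \<in> Arr C \<Longrightarrow> Dom C f \<in> Obj C"
    and Cod_in_Obj: "f \<in> Arr C \<Longrightarrow> Cod C f \<in> Obj C"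
    and Idn_in_hom: "x \<in> Obj C \<Longrightarrow> Idn C x \<in> hom C x x"
    and Cmp_in_hom: "\<lbrakk>f \<in> hom C x y; g \<in> hom C y z\<rbrakk> \<Longrightarrow> g \<cdot> f \<in> hom C x z"
    and Cmp_Idn_left: "f \<in> hom C x y \<Longrightarrow> Idn C y \<cdot> f = f"
    and Cmp_Idn_right: "f \<in> hom C x y \<Longrightarrow> f \<cdot> Idn C x = f"
    and Cmp_assoc: "\<lbrakk>f \<in> hom C w x; g \<in> hom C x y; h \<in> hom C y z\<rbrakk>
      \<Longrightarrow> (h \<cdot> g) \<cdot> f = h \<cdot> (g \<cdot> f)"

definition iso :: "('o, 'a, 'z) cat_scheme \<Rightarrow> 'o \<Rightarrow> 'o \<Rightarrow> 'a \<Rightarrow> bool" where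
  "iso C x y f \<longleftrightarrow> f \<in> hom C x y \<and>
     (\<exists>g \<in> hom C y x. g \<cdot>\<^bsub>C\<^esub> f = Idn C x \<and> f \<cdot>\<^bsub>C\<^esub> g = Idn C y)"

definition prod_cat :: "('o, 'a, 'y) cat_scheme \<Rightarrow> ('p, 'b, 'z) cat_scheme \<Rightarrow> ('o \<times> 'p, 'a \<times> 'b) cat" where
  "prod_cat C D =
     \<lparr>Obj = Obj C \<times> Obj D,
      Arr = Arr C \<times> Arr D,
      Dom = (\<lambda>(f, g). (Dom C f, Dom D g)),
      Cod = (\<lambda>(f, g). (Cod C f, Cod D g)),
      Idn = (\<lambda>(x, y). (Idn C x, Idn D y)),
      Cmp = (\<lambda>(f', g') (f, g). (f' \<cdot>\<^bsub>C\<^esub> f, g' \<cdot>\<^bsub>D\<^esub> g))\<rparr>"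

record ('o, 'a, 'p, 'b) fctr =
  FO :: "'o \<Rightarrow> 'p"
  FA :: "'a \<Rightarrow> 'b"

locale cat_functor = A: category A + B: category B
  for A :: "('o, 'a, 'y) cat_scheme" and B :: "('p, 'b, 'z) cat_scheme"
    and F :: "('o, 'a, 'p, 'b) fctr" +
  assumes FO_in_Obj: "x \<in> Obj A \<Longrightarrow> FO F x \<in> Obj B"
    and FA_in_hom: "f \<in> hom A x y \<Longrightarrow> FA F f \<in> hom B (FO F x) (FO F y)"
    and FA_Idn: "x \<in> Obj A \<Longrightarrow> FA F (Idn A x) = Idn B (FO F x)"
    and FA_Cmp: "\<lbrakk>f \<in> hom A x y; g \<in> hom A y z\<rbrakk> \<Longrightarrow> FA F (g \<cdot>\<^bsub>A\<^esub> f) = FA F g \<cdot>\<^bsub>B\<^esub> FA F f"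

definition fctr_comp :: "('p, 'b, 'q, 'c) fctr \<Rightarrow> ('o, 'a, 'p, 'b) fctr \<Rightarrow> ('o, 'a, 'q, 'c) fctr" where
  "fctr_comp G F = \<lparr>FO = FO G \<circ> FO F, FA = FA G \<circ> FA F\<rparr>"

text \<open>
  \<open>adjoint A B F G\<close>: the functor \<open>F : A \<rightarrow> B\<close> is left adjoint to \<open>G : B \<rightarrow> A\<close>, that is, there are
  bijections \<open>B(F x, y) \<cong> A(x, G y)\<close> natural in \<open>x\<close> and \<open>y\<close>.
\<close>

definition adjoint ::
  "('o, 'a, 'y) cat_scheme \<Rightarrow> ('p, 'b, 'z) cat_scheme \<Rightarrow>
   ('o, 'a, 'p, 'b) fctr \<Rightarrow> ('p, 'b, 'o, 'a) fctr \<Rightarrow> bool" where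
  "adjoint A B F G \<longleftrightarrow>
     cat_functor A B F \<and> cat_functor B A G \<and>
     (\<exists>\<phi>. (\<forall>x \<in> Obj A. \<forall>y \<in> Obj B.
              bij_betw (\<phi> x y) (hom B (FO F x) y) (hom A x (FO G y))) \<and>
          (\<forall>x \<in> Obj A. \<forall>x' \<in> Obj A. \<forall>y \<in> Obj B. \<forall>y' \<in> Obj B.
             \<forall>f \<in> hom A x' x. \<forall>g \<in> hom B y y'. \<forall>h \<in> hom B (FO F x) y.
               \<phi> x' y' (g \<cdot>\<^bsub>B\<^esub> h \<cdot>\<^bsub>B\<^esub> FA F f) = FA G g \<cdot>\<^bsub>A\<^esub> \<phi> x y h \<cdot>\<^bsub>A\<^esub> f))"


section \<open>Limits and colimits\<close>

definition is_cone ::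
  "('i, 'k, 'y) cat_scheme \<Rightarrow> ('o, 'a, 'z) cat_scheme \<Rightarrow> ('i, 'k, 'o, 'a) fctr \<Rightarrow>
   'o \<Rightarrow> ('i \<Rightarrow> 'a) \<Rightarrow> bool" where
  "is_cone J C D x p \<longleftrightarrow> x \<in> Obj C \<and>
     (\<forall>j \<in> Obj J. p j \<in> hom C x (FO D j)) \<and>
     (\<forall>k \<in> Arr J. FA D k \<cdot>\<^bsub>C\<^esub> p (Dom J k) = p (Cod J k))"

definition is_limit ::
  "('i, 'k, 'y) cat_scheme \<Rightarrow> ('o, 'a, 'z) cat_scheme \<Rightarrow> ('i, 'k, 'o, 'a) fctr \<Rightarrow>
   'o \<Rightarrow> ('i \<Rightarrow> 'a) \<Rightarrow> bool" where
  "is_limit J C D x p \<longleftrightarrow> is_cone J C D x p \<and>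
     (\<forall>y q. is_cone J C D y q \<longrightarrow>
        (\<exists>!h. h \<in> hom C y x \<and> (\<forall>j \<in> Obj J. p j \<cdot>\<^bsub>C\<^esub> h = q j)))"

definition is_cocone ::
  "('i, 'k, 'y) cat_scheme \<Rightarrow> ('o, 'a, 'z) cat_scheme \<Rightarrow> ('i, 'k, 'o, 'a) fctr \<Rightarrow>
   'o \<Rightarrow> ('i \<Rightarrow> 'a) \<Rightarrow> bool" where
  "is_cocone J C D x p \<longleftrightarrow> x \<in> Obj C \<and>
     (\<forall>j \<in> Obj J. p j \<in> hom C (FO D j) x) \<and>
     (\<forall>k \<in> Arr J. p (Cod J k) \<cdot>\<^bsub>C\<^esub> FA D k = p (Dom J k))"

definition is_colimit ::
  "('i, 'k, 'y) cat_scheme \<Rightarrow> ('o, 'a, 'z) cat_scheme \<Rightarrow> ('i, 'k, 'o, 'a) fctr \<Rightarrow>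
   'o \<Rightarrow> ('i \<Rightarrow> 'a) \<Rightarrow> bool" where
  "is_colimit J C D x p \<longleftrightarrow> is_cocone J C D x p \<and>
     (\<forall>y q. is_cocone J C D y q \<longrightarrow>
        (\<exists>!h. h \<in> hom C x y \<and> (\<forall>j \<in> Obj J. h \<cdot>\<^bsub>C\<^esub> p j = q j)))"

text \<open>
  Size is measured by a type \<open>'u\<close> that plays the role of the universe: a category is \<open>'u\<close>-small if
  its set of arrows has strictly smaller cardinality than \<open>'u\<close>.  It is then isomorphic to one whose
  objects and arrows are elements of \<open>'u\<close>, so the index categories below are taken of that form.
  (Completeness has to be relative to such a notion of smallness, since the quantification over
  diagrams cannot range over all types, and a category with limits of the size of its own set of
  arrows would be a preorder.)
\<close>

definition small :: "('u, 'u) cat \<Rightarrow> bool" where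
  "small J \<longleftrightarrow> category J \<and> Arr J \<prec> (UNIV :: 'u set)"

definition complete_cat :: "'u itself \<Rightarrow> ('o, 'a, 'z) cat_scheme \<Rightarrow> bool" where
  "complete_cat _ C \<longleftrightarrow>
     (\<forall>(J :: ('u, 'u) cat) D. small J \<and> cat_functor J C D \<longrightarrow> (\<exists>x p. is_limit J C D x p))"

definition cocomplete_cat :: "'u itself \<Rightarrow> ('o, 'a, 'z) cat_scheme \<Rightarrow> bool" where
  "cocomplete_cat _ C \<longleftrightarrow>
     (\<forall>(J :: ('u, 'u) cat) D. small J \<and> cat_functor J C D \<longrightarrow> (\<exists>x p. is_colimit J C D x p))"

definition preserves_colimits ::
  "'u itself \<Rightarrow> ('o, 'a, 'y) cat_scheme \<Rightarrow> ('p, 'b, 'z) cat_scheme \<Rightarrow>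
   ('o, 'a, 'p, 'b) fctr \<Rightarrow> bool" where
  "preserves_colimits _ A B F \<longleftrightarrow>
     (\<forall>(J :: ('u, 'u) cat) D x p.
        small J \<and> cat_functor J A D \<and> is_colimit J A D x p \<longrightarrow>
        is_colimit J B (fctr_comp F D) (FO F x) (FA F \<circ> p))"

definition is_coequalizer ::
  "('o, 'a, 'z) cat_scheme \<Rightarrow> 'a \<Rightarrow> 'a \<Rightarrow> 'o \<Rightarrow> 'a \<Rightarrow> bool" where
  "is_coequalizer C f g z q \<longleftrightarrow>
     f \<in> Arr C \<and> g \<in> Arr C \<and> Dom C f = Dom C g \<and> Cod C f = Cod C g \<and>
     q \<in> hom C (Cod C f) z \<and> q \<cdot>\<^bsub>C\<^esub> f = q \<cdot>\<^bsub>C\<^esub> g \<and>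
     (\<forall>w. \<forall>k \<in> hom C (Cod C f) w. k \<cdot>\<^bsub>C\<^esub> f = k \<cdot>\<^bsub>C\<^esub> g \<longrightarrow>
        (\<exists>!h. h \<in> hom C z w \<and> h \<cdot>\<^bsub>C\<^esub> q = k))"


section \<open>Closed symmetric monoidal categories\<close>

record ('o, 'a) smcat = "('o, 'a) cat" +
  Tensor :: "('o \<times> 'o, 'a \<times> 'a, 'o, 'a) fctr"
  Unit :: 'o
  Assoc :: "'o \<Rightarrow> 'o \<Rightarrow> 'o \<Rightarrow> 'a"
  LUnit :: "'o \<Rightarrow> 'a"
  RUnit :: "'o \<Rightarrow> 'a"
  Braid :: "'o \<Rightarrow> 'o \<Rightarrow> 'a"

definition tensor_ob :: "('o, 'a, 'z) smcat_scheme \<Rightarrow> 'o \<Rightarrow> 'o \<Rightarrow> 'o"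
    (\<open>(_ \<otimes>\<^sub>o\<index> _)\<close> [71, 71] 70) where
  "tensor_ob C x y = FO (Tensor C) (x, y)"

definition tensor_ar :: "('o, 'a, 'z) smcat_scheme \<Rightarrow> 'a \<Rightarrow> 'a \<Rightarrow> 'a"
    (\<open>(_ \<otimes>\<index> _)\<close> [71, 71] 70) where
  "tensor_ar C f g = FA (Tensor C) (f, g)"

text \<open>
  The associativity isomorphisms point in the direction \<open>x \<otimes> (y \<otimes> z) \<rightarrow> (x \<otimes> y) \<otimes> z\<close>, matching
  the direction of those of an actegory.
\<close>

locale symmetric_monoidal_category = category C
  for C :: "('o, 'a, 'z) smcat_scheme" (structure) +
  assumes Tensor_functor: "cat_functor (prod_cat C C) C (Tensor C)"
    and Unit_in_Obj: "Unit C \<in> Obj C"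
    and Assoc_iso: "\<lbrakk>x \<in> Obj C; y \<in> Obj C; z \<in> Obj C\<rbrakk>
      \<Longrightarrow> iso C (x \<otimes>\<^sub>o (y \<otimes>\<^sub>o z)) ((x \<otimes>\<^sub>o y) \<otimes>\<^sub>o z) (Assoc C x y z)"
    and Assoc_natural: "\<lbrakk>f \<in> hom C x x'; g \<in> hom C y y'; h \<in> hom C z z'\<rbrakk>
      \<Longrightarrow> Assoc C x' y' z' \<cdot> (f \<otimes> (g \<otimes> h)) = ((f \<otimes> g) \<otimes> h) \<cdot> Assoc C x y z"
    and LUnit_iso: "x \<in> Obj C \<Longrightarrow> iso C (Unit C \<otimes>\<^sub>o x) x (LUnit C x)"
    and LUnit_natural: "f \<in> hom C x x' \<Longrightarrow> LUnit C x' \<cdot> (Idn C (Unit C) \<otimes> f) = f \<cdot> LUnit C x"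
    and RUnit_iso: "x \<in> Obj C \<Longrightarrow> iso C (x \<otimes>\<^sub>o Unit C) x (RUnit C x)"
    and RUnit_natural: "f \<in> hom C x x' \<Longrightarrow> RUnit C x' \<cdot> (f \<otimes> Idn C (Unit C)) = f \<cdot> RUnit C x"
    and Braid_iso: "\<lbrakk>x \<in> Obj C; y \<in> Obj C\<rbrakk> \<Longrightarrow> iso C (x \<otimes>\<^sub>o y) (y \<otimes>\<^sub>o x) (Braid C x y)"
    and Braid_natural: "\<lbrakk>f \<in> hom C x x'; g \<in> hom C y y'\<rbrakk>
      \<Longrightarrow> Braid C x' y' \<cdot> (f \<otimes> g) = (g \<otimes> f) \<cdot> Braid C x y"
    and pentagon: "\<lbrakk>w \<in> Obj C; x \<in> Obj C; y \<in> Obj C; z \<in> Obj C\<rbrakk>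
      \<Longrightarrow> Assoc C (w \<otimes>\<^sub>o x) y z \<cdot> Assoc C w x (y \<otimes>\<^sub>o z) =
          (Assoc C w x y \<otimes> Idn C z) \<cdot> Assoc C w (x \<otimes>\<^sub>o y) z \<cdot> (Idn C w \<otimes> Assoc C x y z)"
    and triangle: "\<lbrakk>x \<in> Obj C; y \<in> Obj C\<rbrakk>
      \<Longrightarrow> (RUnit C x \<otimes> Idn C y) \<cdot> Assoc C x (Unit C) y = Idn C x \<otimes> LUnit C y"
    and symmetry: "\<lbrakk>x \<in> Obj C; y \<in> Obj C\<rbrakk> \<Longrightarrow> Braid C y x \<cdot> Braid C x y = Idn C (x \<otimes>\<^sub>o y)"
    and hexagon: "\<lbrakk>x \<in> Obj C; y \<in> Obj C; z \<in> Obj C\<rbrakk>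
      \<Longrightarrow> Assoc C z x y \<cdot> Braid C (x \<otimes>\<^sub>o y) z \<cdot> Assoc C x y z =
          (Braid C x z \<otimes> Idn C y) \<cdot> Assoc C x z y \<cdot> (Idn C x \<otimes> Braid C y z)"

definition tensor_right :: "('o, 'a, 'z) smcat_scheme \<Rightarrow> 'o \<Rightarrow> ('o, 'a, 'o, 'a) fctr" where
  "tensor_right C y = \<lparr>FO = (\<lambda>x. x \<otimes>\<^sub>o\<^bsub>C\<^esub> y), FA = (\<lambda>f. f \<otimes>\<^bsub>C\<^esub> Idn C y)\<rparr>"

locale closed_symmetric_monoidal_category = symmetric_monoidal_category C
  for C :: "('o, 'a, 'z) smcat_scheme" (structure) +
  assumes closed: "y \<in> Obj C \<Longrightarrow> \<exists>G. adjoint C C (tensor_right C y) G"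


section \<open>The category of commutative monoids\<close>

record ('o, 'a) mon =
  Car :: 'o
  Mul :: 'a
  Uni :: 'a

definition comm_monoid_ob :: "('o, 'a, 'z) smcat_scheme \<Rightarrow> ('o, 'a) mon \<Rightarrow> bool" where
  "comm_monoid_ob C A \<longleftrightarrow>
     Car A \<in> Obj C \<and>
     Mul A \<in> hom C (Car A \<otimes>\<^sub>o\<^bsub>C\<^esub> Car A) (Car A) \<and>
     Uni A \<in> hom C (Unit C) (Car A) \<and>
     Mul A \<cdot>\<^bsub>C\<^esub> (Mul A \<otimes>\<^bsub>C\<^esub> Idn C (Car A)) \<cdot>\<^bsub>C\<^esub> Assoc C (Car A) (Car A) (Car A) =
       Mul A \<cdot>\<^bsub>C\<^esub> (Idn C (Car A) \<otimes>\<^bsub>C\<^esub> Mul A) \<and>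
     Mul A \<cdot>\<^bsub>C\<^esub> (Uni A \<otimes>\<^bsub>C\<^esub> Idn C (Car A)) = LUnit C (Car A) \<and>
     Mul A \<cdot>\<^bsub>C\<^esub> (Idn C (Car A) \<otimes>\<^bsub>C\<^esub> Uni A) = RUnit C (Car A) \<and>
     Mul A \<cdot>\<^bsub>C\<^esub> Braid C (Car A) (Car A) = Mul A"

definition monoid_mor ::
  "('o, 'a, 'z) smcat_scheme \<Rightarrow> ('o, 'a) mon \<Rightarrow> ('o, 'a) mon \<Rightarrow> 'a \<Rightarrow> bool" where
  "monoid_mor C A B \<alpha> \<longleftrightarrow>
     \<alpha> \<in> hom C (Car A) (Car B) \<and>
     \<alpha> \<cdot>\<^bsub>C\<^esub> Mul A = Mul B \<cdot>\<^bsub>C\<^esub> (\<alpha> \<otimes>\<^bsub>C\<^esub> \<alpha>) \<and>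
     \<alpha> \<cdot>\<^bsub>C\<^esub> Uni A = Uni B"

text \<open>
  An arrow of the category of commutative monoids is an underlying arrow tagged with its domain and
  codomain, because the same underlying arrow may be a morphism between different monoids; likewise
  for modules.
\<close>

definition Comm ::
  "('o, 'a, 'z) smcat_scheme \<Rightarrow> (('o, 'a) mon, ('o, 'a) mon \<times> 'a \<times> ('o, 'a) mon) cat" where
  "Comm C =
     \<lparr>Obj = {A. comm_monoid_ob C A},
      Arr = {(A, \<alpha>, B). comm_monoid_ob C A \<and> comm_monoid_ob C B \<and> monoid_mor C A B \<alpha>},
      Dom = (\<lambda>(A, \<alpha>, B). A),
      Cod = (\<lambda>(A, \<alpha>, B). B),
      Idn = (\<lambda>A. (A, Idn C (Car A), A)),
      Cmp = (\<lambda>(B', \<beta>, D) (A, \<alpha>, B). (A, \<beta> \<cdot>\<^bsub>C\<^esub> \<alpha>, D))\<rparr>"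


section \<open>Actegories\<close>

record ('c, 'd, 'o, 'a) acteg = "('o, 'a) cat" +
  Act :: "('c \<times> 'o, 'd \<times> 'a, 'o, 'a) fctr"
  ActAssoc :: "'c \<Rightarrow> 'c \<Rightarrow> 'o \<Rightarrow> 'a"
  ActUnit :: "'o \<Rightarrow> 'a"

definition act_ob :: "('c, 'd, 'o, 'a, 'z) acteg_scheme \<Rightarrow> 'c \<Rightarrow> 'o \<Rightarrow> 'o"
    (\<open>(_ \<odot>\<^sub>o\<index> _)\<close> [71, 71] 70) where
  "act_ob M x m = FO (Act M) (x, m)"

definition act_ar :: "('c, 'd, 'o, 'a, 'z) acteg_scheme \<Rightarrow> 'd \<Rightarrow> 'a \<Rightarrow> 'a"
    (\<open>(_ \<odot>\<index> _)\<close> [71, 71] 70) where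
  "act_ar M f \<psi> = FA (Act M) (f, \<psi>)"

text \<open>
  The unit law \<open>act_triangle_left\<close> follows from the other axioms; it is included, as is common,
  so that both unit triangles are directly available.
\<close>

locale actegory = C: symmetric_monoidal_category C + M: category M
  for C :: "('c, 'd, 'y) smcat_scheme" and M :: "('c, 'd, 'o, 'a, 'z) acteg_scheme" +
  assumes Act_functor: "cat_functor (prod_cat C M) M (Act M)"
    and ActAssoc_iso: "\<lbrakk>x \<in> Obj C; y \<in> Obj C; m \<in> Obj M\<rbrakk>
      \<Longrightarrow> iso M (x \<odot>\<^sub>o\<^bsub>M\<^esub> (y \<odot>\<^sub>o\<^bsub>M\<^esub> m)) ((x \<otimes>\<^sub>o\<^bsub>C\<^esub> y) \<odot>\<^sub>o\<^bsub>M\<^esub> m) (ActAssoc M x y m)"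
    and ActAssoc_natural: "\<lbrakk>f \<in> hom C x x'; g \<in> hom C y y'; \<psi> \<in> hom M m m'\<rbrakk>
      \<Longrightarrow> ActAssoc M x' y' m' \<cdot>\<^bsub>M\<^esub> (f \<odot>\<^bsub>M\<^esub> (g \<odot>\<^bsub>M\<^esub> \<psi>)) =
          ((f \<otimes>\<^bsub>C\<^esub> g) \<odot>\<^bsub>M\<^esub> \<psi>) \<cdot>\<^bsub>M\<^esub> ActAssoc M x y m"
    and ActUnit_iso: "m \<in> Obj M \<Longrightarrow> iso M (Unit C \<odot>\<^sub>o\<^bsub>M\<^esub> m) m (ActUnit M m)"
    and ActUnit_natural: "\<psi> \<in> hom M m m'
      \<Longrightarrow> ActUnit M m' \<cdot>\<^bsub>M\<^esub> (Idn C (Unit C) \<odot>\<^bsub>M\<^esub> \<psi>) = \<psi> \<cdot>\<^bsub>M\<^esub> ActUnit M m"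
    and act_pentagon: "\<lbrakk>x \<in> Obj C; y \<in> Obj C; z \<in> Obj C; m \<in> Obj M\<rbrakk>
      \<Longrightarrow> ActAssoc M (x \<otimes>\<^sub>o\<^bsub>C\<^esub> y) z m \<cdot>\<^bsub>M\<^esub> ActAssoc M x y (z \<odot>\<^sub>o\<^bsub>M\<^esub> m) =
          (Assoc C x y z \<odot>\<^bsub>M\<^esub> Idn M m) \<cdot>\<^bsub>M\<^esub> ActAssoc M x (y \<otimes>\<^sub>o\<^bsub>C\<^esub> z) m \<cdot>\<^bsub>M\<^esub>
            (Idn C x \<odot>\<^bsub>M\<^esub> ActAssoc M y z m)"
    and act_triangle: "\<lbrakk>x \<in> Obj C; m \<in> Obj M\<rbrakk>
      \<Longrightarrow> (RUnit C x \<odot>\<^bsub>M\<^esub> Idn M m) \<cdot>\<^bsub>M\<^esub> ActAssoc M x (Unit C) m = Idn C x \<odot>\<^bsub>M\<^esub> ActUnit M m"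
    and act_triangle_left: "\<lbrakk>x \<in> Obj C; m \<in> Obj M\<rbrakk>
      \<Longrightarrow> (LUnit C x \<odot>\<^bsub>M\<^esub> Idn M m) \<cdot>\<^bsub>M\<^esub> ActAssoc M (Unit C) x m = ActUnit M (x \<odot>\<^sub>o\<^bsub>M\<^esub> m)"

definition act_on_left ::
  "('c, 'd, 'y) smcat_scheme \<Rightarrow> ('c, 'd, 'o, 'a, 'z) acteg_scheme \<Rightarrow> 'c \<Rightarrow> ('o, 'a, 'o, 'a) fctr" where
  "act_on_left C M x = \<lparr>FO = (\<lambda>m. x \<odot>\<^sub>o\<^bsub>M\<^esub> m), FA = (\<lambda>\<psi>. Idn C x \<odot>\<^bsub>M\<^esub> \<psi>)\<rparr>"

definition act_on_right ::
  "('c, 'd, 'o, 'a, 'z) acteg_scheme \<Rightarrow> 'o \<Rightarrow> ('c, 'd, 'o, 'a) fctr" where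
  "act_on_right M m = \<lparr>FO = (\<lambda>x. x \<odot>\<^sub>o\<^bsub>M\<^esub> m), FA = (\<lambda>f. f \<odot>\<^bsub>M\<^esub> Idn M m)\<rparr>"


section \<open>Modules, restriction and extension of scalars\<close>

definition module_ob ::
  "('c, 'd, 'y) smcat_scheme \<Rightarrow> ('c, 'd, 'o, 'a, 'z) acteg_scheme \<Rightarrow> ('c, 'd) mon \<Rightarrow>
   'o \<times> 'a \<Rightarrow> bool" where
  "module_ob C M A = (\<lambda>(m, \<rho>).
     m \<in> Obj M \<and>
     \<rho> \<in> hom M (Car A \<odot>\<^sub>o\<^bsub>M\<^esub> m) m \<and>
     \<rho> \<cdot>\<^bsub>M\<^esub> (Mul A \<odot>\<^bsub>M\<^esub> Idn M m) \<cdot>\<^bsub>M\<^esub> ActAssoc M (Car A) (Car A) m =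
       \<rho> \<cdot>\<^bsub>M\<^esub> (Idn C (Car A) \<odot>\<^bsub>M\<^esub> \<rho>) \<and>
     \<rho> \<cdot>\<^bsub>M\<^esub> (Uni A \<odot>\<^bsub>M\<^esub> Idn M m) = ActUnit M m)"

definition module_mor ::
  "('c, 'd, 'y) smcat_scheme \<Rightarrow> ('c, 'd, 'o, 'a, 'z) acteg_scheme \<Rightarrow> ('c, 'd) mon \<Rightarrow>
   'o \<times> 'a \<Rightarrow> 'o \<times> 'a \<Rightarrow> 'a \<Rightarrow> bool" where
  "module_mor C M A = (\<lambda>(m, \<rho>) (m', \<rho>') \<psi>.
     \<psi> \<in> hom M m m' \<and> \<rho>' \<cdot>\<^bsub>M\<^esub> (Idn C (Car A) \<odot>\<^bsub>M\<^esub> \<psi>) = \<psi> \<cdot>\<^bsub>M\<^esub> \<rho>)"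

definition Mod ::
  "('c, 'd, 'y) smcat_scheme \<Rightarrow> ('c, 'd, 'o, 'a, 'z) acteg_scheme \<Rightarrow> ('c, 'd) mon \<Rightarrow>
   ('o \<times> 'a, ('o \<times> 'a) \<times> 'a \<times> ('o \<times> 'a)) cat" where
  "Mod C M A =
     \<lparr>Obj = {X. module_ob C M A X},
      Arr = {(X, \<psi>, Y). module_ob C M A X \<and> module_ob C M A Y \<and> module_mor C M A X Y \<psi>},
      Dom = (\<lambda>(X, \<psi>, Y). X),
      Cod = (\<lambda>(X, \<psi>, Y). Y),
      Idn = (\<lambda>X. (X, Idn M (fst X), X)),
      Cmp = (\<lambda>(Y', \<chi>, Z) (X, \<psi>, Y). (X, \<chi> \<cdot>\<^bsub>M\<^esub> \<psi>, Z))\<rparr>"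

definition restrict_ob ::
  "('c, 'd, 'o, 'a, 'z) acteg_scheme \<Rightarrow> 'd \<Rightarrow> 'o \<times> 'a \<Rightarrow> 'o \<times> 'a" where
  "restrict_ob M \<alpha> = (\<lambda>(n, \<tau>). (n, \<tau> \<cdot>\<^bsub>M\<^esub> (\<alpha> \<odot>\<^bsub>M\<^esub> Idn M n)))"

definition restriction_of_scalars ::
  "('c, 'd, 'o, 'a, 'z) acteg_scheme \<Rightarrow> 'd \<Rightarrow>
   ('o \<times> 'a, ('o \<times> 'a) \<times> 'a \<times> ('o \<times> 'a), 'o \<times> 'a, ('o \<times> 'a) \<times> 'a \<times> ('o \<times> 'a)) fctr" where
  "restriction_of_scalars M \<alpha> =
     \<lparr>FO = restrict_ob M \<alpha>,
      FA = (\<lambda>(X, \<psi>, Y). (restrict_ob M \<alpha> X, \<psi>, restrict_ob M \<alpha> Y))\<rparr>"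

text \<open>
  The parallel pair \<open>b \<odot> (a \<odot> m) \<rightrightarrows> b \<odot> m\<close> whose coequalizer is \<open>b \<odot>\<^sub>a m\<close>.
\<close>

definition ext_pair1 ::
  "('c, 'd, 'y) smcat_scheme \<Rightarrow> ('c, 'd, 'o, 'a, 'z) acteg_scheme \<Rightarrow> ('c, 'd) mon \<Rightarrow>
   'o \<times> 'a \<Rightarrow> 'a" where
  "ext_pair1 C M B = (\<lambda>(m, \<rho>). Idn C (Car B) \<odot>\<^bsub>M\<^esub> \<rho>)"

definition ext_pair2 ::
  "('c, 'd, 'y) smcat_scheme \<Rightarrow> ('c, 'd, 'o, 'a, 'z) acteg_scheme \<Rightarrow> ('c, 'd) mon \<Rightarrow>
   ('c, 'd) mon \<Rightarrow> 'd \<Rightarrow> 'o \<times> 'a \<Rightarrow> 'a" where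
  "ext_pair2 C M A B \<alpha> = (\<lambda>(m, \<rho>).
     ((Mul B \<cdot>\<^bsub>C\<^esub> (Idn C (Car B) \<otimes>\<^bsub>C\<^esub> \<alpha>)) \<odot>\<^bsub>M\<^esub> Idn M m) \<cdot>\<^bsub>M\<^esub> ActAssoc M (Car B) (Car A) m)"

text \<open>
  A choice of the objects \<open>b \<odot>\<^sub>a m\<close> together with their canonical morphisms, for all \<open>a\<close>-modules
  \<open>(m, \<rho>)\<close>; colimits being unique only up to isomorphism, the construction depends on it.
\<close>

definition ext_choice ::
  "('c, 'd, 'y) smcat_scheme \<Rightarrow> ('c, 'd, 'o, 'a, 'z) acteg_scheme \<Rightarrow> ('c, 'd) mon \<Rightarrow>
   ('c, 'd) mon \<Rightarrow> 'd \<Rightarrow> ('o \<times> 'a \<Rightarrow> 'o) \<Rightarrow> ('o \<times> 'a \<Rightarrow> 'a) \<Rightarrow> bool" where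
  "ext_choice C M A B \<alpha> Q coeq \<longleftrightarrow>
     (\<forall>X \<in> Obj (Mod C M A).
        is_coequalizer M (ext_pair1 C M B X) (ext_pair2 C M A B \<alpha> X) (Q X) (coeq X))"

text \<open>
  The induced action \<open>b \<odot> (b \<odot>\<^sub>a m) \<rightarrow> b \<odot>\<^sub>a m\<close>, where \<open>q : b \<odot> m \<rightarrow> z\<close> is the canonical morphism
  to \<open>z = b \<odot>\<^sub>a m\<close>.
\<close>

definition ext_action ::
  "('c, 'd, 'y) smcat_scheme \<Rightarrow> ('c, 'd, 'o, 'a, 'z) acteg_scheme \<Rightarrow> ('c, 'd) mon \<Rightarrow>
   'o \<Rightarrow> 'o \<Rightarrow> 'a \<Rightarrow> 'a" where
  "ext_action C M B m z q = (THE r.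
     r \<in> hom M (Car B \<odot>\<^sub>o\<^bsub>M\<^esub> z) z \<and>
     r \<cdot>\<^bsub>M\<^esub> (Idn C (Car B) \<odot>\<^bsub>M\<^esub> q) =
       q \<cdot>\<^bsub>M\<^esub> (Mul B \<odot>\<^bsub>M\<^esub> Idn M m) \<cdot>\<^bsub>M\<^esub> ActAssoc M (Car B) (Car B) m)"

end

theory Submission
  imports Defs
begin

text \<open>
  Write \<open>b\<close> for the object underlying \<open>B\<close>.  The object \<open>b \<odot> m\<close> carries the action
  \<open>(\<mu> \<odot> m) \<cdot> \<lambda>\<close>, which makes it the free \<open>B\<close>-module on \<open>m\<close>: the module morphisms
  \<open>b \<odot> m \<rightarrow> (n, \<tau>)\<close> are the extensions \<open>\<tau> \<cdot> (b \<odot> f)\<close> of arrows \<open>f : m \<rightarrow> n\<close>, and \<open>f\<close> is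
  recovered from its extension by restricting to generators (\<open>free_extension_mor\<close>,
  \<open>free_extension_unit\<close>, \<open>free_mor_eq_extension\<close>).

  For an \<open>A\<close>-module \<open>(m, \<rho>)\<close> the two arrows \<open>b \<odot> (a \<odot> m) \<rightrightarrows> b \<odot> m\<close> with coequalizer
  \<open>b \<odot>\<^sub>a m\<close> are morphisms of free \<open>B\<close>-modules.  Composed with the extension of \<open>f\<close>, they give the
  extensions of \<open>f \<cdot> \<rho>\<close> and of \<open>\<tau> \<cdot> (\<alpha> \<odot> f)\<close>.  Therefore the extension of \<open>f\<close> coequalizes the
  pair if and only if \<open>f\<close> is \<open>A\<close>-linear from \<open>(m, \<rho>)\<close> to the restriction of \<open>(n, \<tau>)\<close>
  (\<open>extension_coequalizes_iff\<close>).

  Because \<open>b \<odot> -\<close> preserves coequalizers, the coequalizer in \<open>M\<close> of two \<open>B\<close>-module morphisms has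
  a unique compatible \<open>B\<close>-action and is then also their coequalizer among modules
  (\<open>coequalizer_action_exists\<close>, \<open>coequalizer_module\<close>, \<open>coequalizer_mor_descends\<close>).  The action so
  obtained on \<open>b \<odot>\<^sub>a m\<close> is the induced one, and \<open>B\<close>-linear arrows \<open>b \<odot>\<^sub>a m \<rightarrow> (n, \<tau>)\<close> correspond
  to \<open>A\<close>-linear arrows \<open>m \<rightarrow> n\<close>.  In other words each \<open>A\<close>-module has a universal arrow to the
  restriction functor (\<open>extension_universal\<close>), and universal arrows assemble into a left adjoint
  (\<open>adjoint_of_universal_arrows\<close>).
\<close>


section \<open>Arrows by domain and codomain\<close>

text \<open>
  The category axioms, restated with the side conditions \<open>Dom g = Cod f\<close> in place of membership
  in hom-sets: no variable occurs in the premises only, so the simplifier can compute the domain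
  and codomain of a composite and bring it into right-nested form.
\<close>

context category
begin

lemma in_homD:
  assumes "f \<in> hom C x y"
  shows "f \<in> Arr C" "Dom C f = x" "Cod C f = y" "x \<in> Obj C" "y \<in> Obj C"
  using assms Dom_in_Obj Cod_in_Obj by (auto simp: hom_def)

lemma Idn_arr [simp]:
  assumes "x \<in> Obj C"
  shows "Idn C x \<in> Arr C" "Dom C (Idn C x) = x" "Cod C (Idn C x) = x"
  using Idn_in_hom[OF assms] by (auto simp: hom_def)

lemma Cmp_arr [simp]:
  assumes "f \<in> Arr C" "g \<in> Arr C" "Dom C g = Cod C f"
  shows "g \<cdot> f \<in> Arr C" "Dom C (g \<cdot> f) = Dom C f" "Cod C (g \<cdot> f) = Cod C g"
  using Cmp_in_hom[of f "Dom C f" "Cod C f" g "Cod C g"] assms by (auto simp: hom_def)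

lemma Cmp_assoc_arr [simp]:
  assumes "f \<in> Arr C" "g \<in> Arr C" "h \<in> Arr C" "Dom C g = Cod C f" "Dom C h = Cod C g"
  shows "(h \<cdot> g) \<cdot> f = h \<cdot> (g \<cdot> f)"
  using Cmp_assoc[of f "Dom C f" "Cod C f" g "Cod C g" h "Cod C h"] assms by (auto simp: hom_def)

lemma Cmp_Idn_left_arr [simp]: "\<lbrakk>f \<in> Arr C; Cod C f = y\<rbrakk> \<Longrightarrow> Idn C y \<cdot> f = f"
  using Cmp_Idn_left[of f "Dom C f" y] by (auto simp: hom_def)

lemma Cmp_Idn_right_arr [simp]: "\<lbrakk>f \<in> Arr C; Dom C f = x\<rbrakk> \<Longrightarrow> f \<cdot> Idn C x = f"
  using Cmp_Idn_right[of f x "Cod C f"] by (auto simp: hom_def)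

text \<open>
  An equation between composites \<open>g \<cdot> f\<close> can be applied in front of any further arrow \<open>e\<close> of a
  right-nested composite.
\<close>

lemma Cmp_eq_extend:
  assumes "g \<cdot> f = g' \<cdot> f'" "f \<in> Arr C" "g \<in> Arr C" "Dom C g = Cod C f"
    "f' \<in> Arr C" "g' \<in> Arr C" "Dom C g' = Cod C f'" "e \<in> Arr C" "Dom C f = Cod C e" "Dom C f' = Cod C e"
  shows "g \<cdot> (f \<cdot> e) = g' \<cdot> (f' \<cdot> e)"
  using assms Cmp_assoc_arr[of e f g] Cmp_assoc_arr[of e f' g'] by simp

end


section \<open>Adjunctions from universal arrows\<close>

text \<open>
  A functor \<open>G\<close> has a left adjoint with prescribed object part \<open>F0\<close> as soon as every \<open>x\<close> has a
  universal arrow \<open>\<eta> x : x \<rightarrow> G (F0 x)\<close>.  On an arrow \<open>f\<close> the left adjoint is the unique solution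
  of \<open>G (F f) \<cdot> \<eta> = \<eta> \<cdot> f\<close>, functoriality is uniqueness, and the bijections are
  \<open>h \<mapsto> G h \<cdot> \<eta> x\<close>.
\<close>

lemma adjoint_of_universal_arrows:
  fixes A :: "('o, 'a, 'y) cat_scheme" and B :: "('p, 'b, 'z) cat_scheme"
  assumes G: "cat_functor B A G"
    and F0: "\<And>x. x \<in> Obj A \<Longrightarrow> F0 x \<in> Obj B"
    and \<eta>: "\<And>x. x \<in> Obj A \<Longrightarrow> \<eta> x \<in> hom A x (FO G (F0 x))"
    and universal: "\<And>x y f. \<lbrakk>x \<in> Obj A; y \<in> Obj B; f \<in> hom A x (FO G y)\<rbrakk>
      \<Longrightarrow> \<exists>!g. g \<in> hom B (F0 x) y \<and> FA G g \<cdot>\<^bsub>A\<^esub> \<eta> x = f"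
  shows "\<exists>F. FO F = F0 \<and> adjoint A B F G"
proof -
  interpret G: cat_functor B A G by (rule G)
  define F1 where "F1 f = (THE g. g \<in> hom B (F0 (Dom A f)) (F0 (Cod A f)) \<and>
      FA G g \<cdot>\<^bsub>A\<^esub> \<eta> (Dom A f) = \<eta> (Cod A f) \<cdot>\<^bsub>A\<^esub> f)" for f
  define F where "F = \<lparr>FO = F0, FA = F1\<rparr>"
  have F1: "F1 f \<in> hom B (F0 x) (F0 y) \<and> FA G (F1 f) \<cdot>\<^bsub>A\<^esub> \<eta> x = \<eta> y \<cdot>\<^bsub>A\<^esub> f"
    if f: "f \<in> hom A x y" for f x y
  proof -
    note f' = G.B.in_homD[OF f]
    have "\<eta> y \<cdot>\<^bsub>A\<^esub> f \<in> hom A x (FO G (F0 y))"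
      using G.B.Cmp_in_hom[OF f \<eta>] f' by blast
    then have "\<exists>!g. g \<in> hom B (F0 x) (F0 y) \<and> FA G g \<cdot>\<^bsub>A\<^esub> \<eta> x = \<eta> y \<cdot>\<^bsub>A\<^esub> f"
      using universal F0 f' by blast
    from theI'[OF this] show ?thesis
      using f' by (simp add: F1_def)
  qed
  have unique: "g = h" if "x \<in> Obj A" "g \<in> hom B (F0 x) y" "h \<in> hom B (F0 x) y"
    "FA G g \<cdot>\<^bsub>A\<^esub> \<eta> x = FA G h \<cdot>\<^bsub>A\<^esub> \<eta> x" for x y g h
  proof -
    have "y \<in> Obj B" using that(2) by (rule G.A.in_homD)
    moreover have "FA G h \<cdot>\<^bsub>A\<^esub> \<eta> x \<in> hom A x (FO G y)"
      using G.B.Cmp_in_hom[OF \<eta>[OF that(1)] G.FA_in_hom[OF that(3)]] .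
    ultimately show ?thesis using universal that by blast
  qed
  have F_functor: "cat_functor A B F"
  proof unfold_locales
    fix x assume "x \<in> Obj A"
    then show "FO F x \<in> Obj B" by (simp add: F_def F0)
  next
    fix f x y assume "f \<in> hom A x y"
    then show "FA F f \<in> hom B (FO F x) (FO F y)" using F1 by (simp add: F_def)
  next
    fix x assume x: "x \<in> Obj A"
    have "FA G (F1 (Idn A x)) \<cdot>\<^bsub>A\<^esub> \<eta> x = FA G (Idn B (F0 x)) \<cdot>\<^bsub>A\<^esub> \<eta> x"
      using F1[OF G.B.Idn_in_hom[OF x]] G.FA_Idn[OF F0[OF x]] G.B.in_homD[OF \<eta>[OF x]] by simp
    then have "F1 (Idn A x) = Idn B (F0 x)"
      using unique[OF x] F1[OF G.B.Idn_in_hom[OF x]] G.A.Idn_in_hom[OF F0[OF x]] by blast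
    then show "FA F (Idn A x) = Idn B (FO F x)" by (simp add: F_def)
  next
    fix f g x y z assume f: "f \<in> hom A x y" and g: "g \<in> hom A y z"
    have gf: "g \<cdot>\<^bsub>A\<^esub> f \<in> hom A x z" using f g by (rule G.B.Cmp_in_hom)
    note [simp] = G.B.in_homD[OF f] G.B.in_homD[OF g]
    note Ff = F1[OF f] and Fg = F1[OF g]
    have comp: "F1 g \<cdot>\<^bsub>B\<^esub> F1 f \<in> hom B (F0 x) (F0 z)" using Ff Fg G.A.Cmp_in_hom by blast
    note [simp] = G.B.in_homD[OF \<eta>[of x]] G.B.in_homD[OF \<eta>[of y]] G.B.in_homD[OF \<eta>[of z]]
      G.B.in_homD[OF G.FA_in_hom, OF conjunct1, OF Ff] G.B.in_homD[OF G.FA_in_hom, OF conjunct1, OF Fg]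
    have "FA G (F1 g \<cdot>\<^bsub>B\<^esub> F1 f) \<cdot>\<^bsub>A\<^esub> \<eta> x = FA G (F1 g) \<cdot>\<^bsub>A\<^esub> (FA G (F1 f) \<cdot>\<^bsub>A\<^esub> \<eta> x)"
      using G.FA_Cmp[of "F1 f" "F0 x" "F0 y" "F1 g" "F0 z"] Ff Fg by simp
    also have "\<dots> = (FA G (F1 g) \<cdot>\<^bsub>A\<^esub> \<eta> y) \<cdot>\<^bsub>A\<^esub> f" using Ff by simp
    also have "\<dots> = (\<eta> z \<cdot>\<^bsub>A\<^esub> g) \<cdot>\<^bsub>A\<^esub> f" using Fg by simp
    also have "\<dots> = FA G (F1 (g \<cdot>\<^bsub>A\<^esub> f)) \<cdot>\<^bsub>A\<^esub> \<eta> x" using F1[OF gf] by simp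
    finally show "FA F (g \<cdot>\<^bsub>A\<^esub> f) = FA F g \<cdot>\<^bsub>B\<^esub> FA F f"
      using unique[OF G.B.in_homD(4)[OF f] _ comp] F1[OF gf] by (simp add: F_def)
  qed
  define \<phi> where "\<phi> x y h = FA G h \<cdot>\<^bsub>A\<^esub> \<eta> x" for x and y :: 'p and h
  have "bij_betw (\<phi> x y) (hom B (FO F x) y) (hom A x (FO G y))"
    if x: "x \<in> Obj A" and y: "y \<in> Obj B" for x y
  proof (rule bij_betw_imageI)
    show "inj_on (\<phi> x y) (hom B (FO F x) y)"
      using unique[OF x] by (auto simp: inj_on_def \<phi>_def F_def)
    show "\<phi> x y ` hom B (FO F x) y = hom A x (FO G y)"
    proof
      show "\<phi> x y ` hom B (FO F x) y \<subseteq> hom A x (FO G y)"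
        using G.B.Cmp_in_hom[OF \<eta>[OF x] G.FA_in_hom] by (auto simp: \<phi>_def F_def)
      show "hom A x (FO G y) \<subseteq> \<phi> x y ` hom B (FO F x) y"
        using universal[OF x y] by (force simp: \<phi>_def F_def image_iff)
    qed
  qed
  moreover have "\<phi> x' y' (g \<cdot>\<^bsub>B\<^esub> h \<cdot>\<^bsub>B\<^esub> FA F f) = FA G g \<cdot>\<^bsub>A\<^esub> \<phi> x y h \<cdot>\<^bsub>A\<^esub> f"
    if x: "x \<in> Obj A" and x': "x' \<in> Obj A" and f: "f \<in> hom A x' x" and g: "g \<in> hom B y y'"
      and h: "h \<in> hom B (FO F x) y" for x x' y y' f g h
  proof -
    have h': "h \<in> hom B (F0 x) y" using h by (simp add: F_def)
    note Ff = F1[OF f]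
    note [simp] = G.B.in_homD[OF f] G.B.in_homD[OF \<eta>[OF x]] G.B.in_homD[OF \<eta>[OF x']]
      G.B.in_homD[OF G.FA_in_hom, OF conjunct1, OF Ff] G.B.in_homD[OF G.FA_in_hom, OF h']
      G.B.in_homD[OF G.FA_in_hom, OF g]
    have "FA G (g \<cdot>\<^bsub>B\<^esub> h \<cdot>\<^bsub>B\<^esub> F1 f) = FA G g \<cdot>\<^bsub>A\<^esub> FA G h \<cdot>\<^bsub>A\<^esub> FA G (F1 f)"
      using G.FA_Cmp[OF G.A.Cmp_in_hom[OF conjunct1[OF Ff] h'] g]
        G.FA_Cmp[OF conjunct1[OF Ff] h'] by simp
    then show ?thesis using Ff by (simp add: \<phi>_def F_def)
  qed
  ultimately have "adjoint A B F G"
    using F_functor G unfolding adjoint_def by (intro conjI exI[of _ \<phi>] ballI) auto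
  then show ?thesis by (intro exI[of _ F]) (simp add: F_def)
qed


section \<open>Coequalizers as colimits\<close>

text \<open>
  The shape \<open>\<bullet> \<rightrightarrows> \<bullet>\<close> realised on four distinct elements of a type: \<open>s\<close> and \<open>t\<close> serve both as
  the two objects and as their identities, \<open>u\<close> and \<open>v\<close> are the parallel arrows from \<open>s\<close> to \<open>t\<close>.
\<close>

definition parallel_pair :: "'u \<Rightarrow> 'u \<Rightarrow> 'u \<Rightarrow> 'u \<Rightarrow> ('u, 'u) cat" where
  "parallel_pair s t u v =
     \<lparr>Obj = {s, t}, Arr = {s, t, u, v},
      Dom = (\<lambda>k. if k = t then t else s),
      Cod = (\<lambda>k. if k = s then s else t),
      Idn = (\<lambda>i. i),
      Cmp = (\<lambda>g f. if f = s \<or> f = t then g else f)\<rparr>"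

definition parallel_diagram ::
  "('o, 'a, 'z) cat_scheme \<Rightarrow> 'u \<Rightarrow> 'u \<Rightarrow> 'u \<Rightarrow> 'a \<Rightarrow> 'a \<Rightarrow> ('u, 'u, 'o, 'a) fctr" where
  "parallel_diagram C s t u f g =
     \<lparr>FO = (\<lambda>i. if i = s then Dom C f else Cod C f),
      FA = (\<lambda>k. if k = s then Idn C (Dom C f) else if k = t then Idn C (Cod C f)
                else if k = u then f else g)\<rparr>"

lemma category_parallel_pair:
  assumes "distinct [s, t, u, v]"
  shows "category (parallel_pair s t u v)"
  by unfold_locales (use assms in \<open>auto simp: parallel_pair_def hom_def split: if_splits\<close>)

lemma small_parallel_pair:
  fixes s t u v :: 'u
  assumes "infinite (UNIV :: 'u set)" "distinct [s, t, u, v]"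
  shows "small (parallel_pair s t u v)"
proof -
  have "{s, t, u, v} \<prec> (UNIV :: 'u set)"
    using assms(1) by (intro finite_lesspoll_infinite) auto
  then show ?thesis
    using category_parallel_pair[OF assms(2)] by (simp add: small_def parallel_pair_def)
qed

context category
begin

lemma parallel_diagram_functor:
  assumes "distinct [s, t, u, v]"
    and "f \<in> Arr C" "g \<in> Arr C" "Dom C f = Dom C g" "Cod C f = Cod C g"
  shows "cat_functor (parallel_pair s t u v) C (parallel_diagram C s t u f g)"
proof -
  interpret J: category "parallel_pair s t u v" by (rule category_parallel_pair[OF assms(1)])
  show ?thesis
    by unfold_locales
      (use assms Dom_in_Obj Cod_in_Obj in
        \<open>auto simp: parallel_pair_def parallel_diagram_def hom_def split: if_splits\<close>)
qed

lemma is_cocone_parallel_iff: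
  assumes "distinct [s, t, u, v]"
    and "f \<in> Arr C" "g \<in> Arr C" "Dom C f = Dom C g" "Cod C f = Cod C g"
  shows "is_cocone (parallel_pair s t u v) C (parallel_diagram C s t u f g) z p \<longleftrightarrow>
    p t \<in> hom C (Cod C f) z \<and> p s = p t \<cdot> f \<and> p t \<cdot> f = p t \<cdot> g"
  using assms Dom_in_Obj Cod_in_Obj
  by (auto simp: is_cocone_def parallel_pair_def parallel_diagram_def hom_def)

text \<open>A cocone on a parallel pair amounts to its component at the target.\<close>

lemma is_colimit_parallel_iff:
  assumes "distinct [s, t, u, v]"
    and "f \<in> Arr C" "g \<in> Arr C" "Dom C f = Dom C g" "Cod C f = Cod C g"
  shows "is_colimit (parallel_pair s t u v) C (parallel_diagram C s t u f g) z p \<longleftrightarrow>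
    is_coequalizer C f g z (p t) \<and> p s = p t \<cdot> f" (is "?colim \<longleftrightarrow> ?coeq")
proof -
  note cocone = is_cocone_parallel_iff[OF assms]
  have st: "s \<noteq> t" using assms(1) by auto
  have Obj: "Obj (parallel_pair s t u v) = {s, t}" by (simp add: parallel_pair_def)
  show ?thesis
  proof
    assume colim: ?colim
    then have p: "p t \<in> hom C (Cod C f) z" "p s = p t \<cdot> f" "p t \<cdot> f = p t \<cdot> g"
      by (auto simp: is_colimit_def cocone)
    have "\<exists>!h. h \<in> hom C z w \<and> h \<cdot> p t = k"
      if k: "k \<in> hom C (Cod C f) w" "k \<cdot> f = k \<cdot> g" for w k
    proof -
      have cok: "is_cocone (parallel_pair s t u v) C (parallel_diagram C s t u f g) w
          (\<lambda>i. if i = s then k \<cdot> f else k)"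
        using k st by (simp add: cocone)
      have ex1: "\<exists>!h. h \<in> hom C z w \<and> h \<cdot> p s = k \<cdot> f \<and> h \<cdot> p t = k"
        using colim[unfolded is_colimit_def, THEN conjunct2, rule_format, of w, OF cok] st
        by (simp add: Obj)
      have "h \<cdot> p s = k \<cdot> f" if "h \<in> hom C z w" "h \<cdot> p t = k" for h
        using that p assms Cmp_assoc_arr[of f "p t" h] by (simp add: hom_def)
      then show ?thesis using ex1 by metis
    qed
    then show ?coeq using p assms by (auto simp: is_coequalizer_def)
  next
    assume coeq: ?coeq
    have "\<exists>!h. h \<in> hom C z w \<and> (\<forall>i \<in> {s, t}. h \<cdot> p i = q i)"
      if q: "q t \<in> hom C (Cod C f) w" "q s = q t \<cdot> f" "q t \<cdot> f = q t \<cdot> g" for w q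
    proof -
      have ex1: "\<exists>!h. h \<in> hom C z w \<and> h \<cdot> p t = q t"
        using coeq q by (auto simp: is_coequalizer_def)
      have "h \<cdot> p s = q s" if "h \<in> hom C z w" "h \<cdot> p t = q t" for h
        using that coeq q assms Cmp_assoc_arr[of f "p t" h] by (auto simp: hom_def is_coequalizer_def)
      then show ?thesis using ex1 by auto
    qed
    then show ?colim
      using coeq unfolding is_colimit_def Obj cocone by (auto simp: is_coequalizer_def)
  qed
qed

end

lemma infinite_UNIV_distinct4:
  assumes "infinite (UNIV :: 'u set)"
  obtains s t u v :: 'u where "distinct [s, t, u, v]"
proof -
  obtain T :: "'u set" where T: "finite T" "card T = 4"
    using infinite_arbitrarily_large[OF assms, of 4] by auto
  obtain xs where xs: "set xs = T" "distinct xs" using finite_distinct_list[OF T(1)] by auto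
  then have "length xs = 4" using T distinct_card by metis
  then obtain s t u v where "xs = [s, t, u, v]"
    by (auto simp: numeral_eq_Suc length_Suc_conv)
  with xs that show ?thesis by blast
qed

lemma coequalizer_exists:
  assumes "infinite (UNIV :: 'u set)" "category C" "cocomplete_cat TYPE('u) C"
    and fg: "f \<in> Arr C" "g \<in> Arr C" "Dom C f = Dom C g" "Cod C f = Cod C g"
  shows "\<exists>z q. is_coequalizer C f g z q"
proof -
  interpret category C by fact
  obtain s t u v :: 'u where d: "distinct [s, t, u, v]" by (rule infinite_UNIV_distinct4[OF assms(1)])
  show ?thesis
    using assms(3) small_parallel_pair[OF assms(1) d] parallel_diagram_functor[OF d fg]
      is_colimit_parallel_iff[OF d fg] unfolding cocomplete_cat_def by meson
qed

text \<open>
  A functor sends the diagram of \<open>f, g\<close> literally to that of their images, so preservation of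
  colimits over the shape \<open>\<bullet> \<rightrightarrows> \<bullet>\<close> is preservation of coequalizers.
\<close>

lemma preserves_coequalizers:
  assumes "infinite (UNIV :: 'u set)" "cat_functor A B F" "preserves_colimits TYPE('u) A B F"
    and coeq: "is_coequalizer A f g z q"
  shows "is_coequalizer B (FA F f) (FA F g) (FO F z) (FA F q)"
proof -
  interpret F: cat_functor A B F by fact
  obtain s t u v :: 'u where d: "distinct [s, t, u, v]" by (rule infinite_UNIV_distinct4[OF assms(1)])
  let ?J = "parallel_pair s t u v" and ?D = "parallel_diagram A s t u f g"
  have fg: "f \<in> Arr A" "g \<in> Arr A" "Dom A f = Dom A g" "Cod A f = Cod A g"
    using coeq by (auto simp: is_coequalizer_def)
  have arr: "FA F k \<in> Arr B" "Dom B (FA F k) = FO F (Dom A k)" "Cod B (FA F k) = FO F (Cod A k)"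
    if "k \<in> Arr A" for k
    using F.FA_in_hom[of k] that by (auto simp: hom_def)
  have st: "s \<noteq> t" using d by auto
  define p where "p = (\<lambda>i. if i = s then q \<cdot>\<^bsub>A\<^esub> f else q)"
  have "is_colimit ?J A ?D z p"
    unfolding F.A.is_colimit_parallel_iff[OF d fg] using coeq st by (simp add: p_def)
  then have "is_colimit ?J B (fctr_comp F ?D) (FO F z) (FA F \<circ> p)"
    using assms(3) small_parallel_pair[OF assms(1) d] F.A.parallel_diagram_functor[OF d fg]
    unfolding preserves_colimits_def by blast
  moreover have "fctr_comp F ?D = parallel_diagram B s t u (FA F f) (FA F g)"
    using fg F.A.Dom_in_Obj F.A.Cod_in_Obj
    by (auto simp: fctr_comp_def parallel_diagram_def fun_eq_iff F.FA_Idn arr)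
  moreover have "(FA F \<circ> p) t = FA F q" using st by (simp add: p_def)
  ultimately show ?thesis
    using F.B.is_colimit_parallel_iff[OF d, of "FA F f" "FA F g"] fg arr by simp
qed

lemma coequalizer_factor:
  assumes "is_coequalizer C f g z q" "k \<cdot>\<^bsub>C\<^esub> f = k \<cdot>\<^bsub>C\<^esub> g" "k \<in> hom C (Cod C f) w"
  shows "\<exists>!h. h \<in> hom C z w \<and> h \<cdot>\<^bsub>C\<^esub> q = k"
  using assms by (simp add: is_coequalizer_def)

lemma coequalizer_cancel:
  assumes "category C" "is_coequalizer C f g z q" "h \<cdot>\<^bsub>C\<^esub> q = h' \<cdot>\<^bsub>C\<^esub> q"
    "h \<in> hom C z w" "h' \<in> hom C z w"
  shows "h = h'"
proof -
  interpret category C by fact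
  have q: "q \<in> hom C (Cod C f) z" "q \<cdot>\<^bsub>C\<^esub> f = q \<cdot>\<^bsub>C\<^esub> g" "f \<in> Arr C" "g \<in> Arr C" "Cod C f = Cod C g"
    using assms(2) by (auto simp: is_coequalizer_def)
  have "h \<cdot>\<^bsub>C\<^esub> q \<in> hom C (Cod C f) w" using q assms(4) Cmp_in_hom by blast
  moreover have "(h \<cdot>\<^bsub>C\<^esub> q) \<cdot>\<^bsub>C\<^esub> f = (h \<cdot>\<^bsub>C\<^esub> q) \<cdot>\<^bsub>C\<^esub> g"
    using q assms(4) by (simp add: hom_def)
  ultimately have "\<exists>!k. k \<in> hom C z w \<and> k \<cdot>\<^bsub>C\<^esub> q = h \<cdot>\<^bsub>C\<^esub> q"
    by (intro coequalizer_factor[OF assms(2)])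
  then show ?thesis using assms(3-5) by metis
qed


section \<open>Calculus in an actegory\<close>

context symmetric_monoidal_category
begin

lemma tensor_ob_Obj [simp]: "\<lbrakk>x \<in> Obj C; y \<in> Obj C\<rbrakk> \<Longrightarrow> x \<otimes>\<^sub>o y \<in> Obj C"
  using cat_functor.FO_in_Obj[OF Tensor_functor, of "(x, y)"]
  by (simp add: tensor_ob_def prod_cat_def)

lemma tensor_arr [simp]:
  assumes "f \<in> Arr C" "g \<in> Arr C"
  shows "f \<otimes> g \<in> Arr C" "Dom C (f \<otimes> g) = Dom C f \<otimes>\<^sub>o Dom C g"
    "Cod C (f \<otimes> g) = Cod C f \<otimes>\<^sub>o Cod C g"
  using cat_functor.FA_in_hom[OF Tensor_functor, of "(f, g)" "(Dom C f, Dom C g)" "(Cod C f, Cod C g)"]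
    assms by (auto simp: tensor_ob_def tensor_ar_def prod_cat_def hom_def)

lemma tensor_Idn [simp]:
  "\<lbrakk>x \<in> Obj C; y \<in> Obj C\<rbrakk> \<Longrightarrow> Idn C x \<otimes> Idn C y = Idn C (x \<otimes>\<^sub>o y)"
  using cat_functor.FA_Idn[OF Tensor_functor, of "(x, y)"]
  by (simp add: tensor_ob_def tensor_ar_def prod_cat_def)

lemma tensor_Cmp [simp]:
  assumes "f \<in> Arr C" "g \<in> Arr C" "f' \<in> Arr C" "g' \<in> Arr C" "Dom C f' = Cod C f" "Dom C g' = Cod C g"
  shows "(f' \<otimes> g') \<cdot> (f \<otimes> g) = (f' \<cdot> f) \<otimes> (g' \<cdot> g)"
  using cat_functor.FA_Cmp[OF Tensor_functor, of "(f, g)" "(Dom C f, Dom C g)" "(Cod C f, Cod C g)"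
      "(f', g')" "(Cod C f', Cod C g')"] assms
  by (auto simp: tensor_ar_def prod_cat_def hom_def)

lemma Assoc_arr [simp]:
  assumes "x \<in> Obj C" "y \<in> Obj C" "z \<in> Obj C"
  shows "Assoc C x y z \<in> Arr C" "Dom C (Assoc C x y z) = x \<otimes>\<^sub>o (y \<otimes>\<^sub>o z)"
    "Cod C (Assoc C x y z) = (x \<otimes>\<^sub>o y) \<otimes>\<^sub>o z"
  using Assoc_iso[OF assms] by (auto simp: iso_def hom_def)

lemma LUnit_arr [simp]:
  assumes "x \<in> Obj C"
  shows "LUnit C x \<in> Arr C" "Dom C (LUnit C x) = Unit C \<otimes>\<^sub>o x" "Cod C (LUnit C x) = x"
  using LUnit_iso[OF assms] by (auto simp: iso_def hom_def)

lemma RUnit_arr [simp]: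
  assumes "x \<in> Obj C"
  shows "RUnit C x \<in> Arr C" "Dom C (RUnit C x) = x \<otimes>\<^sub>o Unit C" "Cod C (RUnit C x) = x"
  using RUnit_iso[OF assms] by (auto simp: iso_def hom_def)

lemmas [simp] = Unit_in_Obj

end

definition act_unit_inv :: "('c, 'd, 'y) smcat_scheme \<Rightarrow> ('c, 'd, 'o, 'a, 'z) acteg_scheme \<Rightarrow> 'o \<Rightarrow> 'a" where
  "act_unit_inv C M m = (SOME k. k \<in> hom M m (Unit C \<odot>\<^sub>o\<^bsub>M\<^esub> m) \<and>
     k \<cdot>\<^bsub>M\<^esub> ActUnit M m = Idn M (Unit C \<odot>\<^sub>o\<^bsub>M\<^esub> m) \<and> ActUnit M m \<cdot>\<^bsub>M\<^esub> k = Idn M m)"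

text \<open>
  The rules below normalise composites in \<open>M\<close>: adjacent images of the action are merged by
  bifunctoriality, and associators are moved to the right past the arrows in which they are natural.
\<close>

context actegory
begin

lemma act_ob_Obj [simp]: "\<lbrakk>x \<in> Obj C; m \<in> Obj M\<rbrakk> \<Longrightarrow> x \<odot>\<^sub>o\<^bsub>M\<^esub> m \<in> Obj M"
  using cat_functor.FO_in_Obj[OF Act_functor, of "(x, m)"]
  by (simp add: act_ob_def prod_cat_def)

lemma act_arr [simp]:
  assumes "f \<in> Arr C" "\<psi> \<in> Arr M"
  shows "f \<odot>\<^bsub>M\<^esub> \<psi> \<in> Arr M" "Dom M (f \<odot>\<^bsub>M\<^esub> \<psi>) = Dom C f \<odot>\<^sub>o\<^bsub>M\<^esub> Dom M \<psi>"
    "Cod M (f \<odot>\<^bsub>M\<^esub> \<psi>) = Cod C f \<odot>\<^sub>o\<^bsub>M\<^esub> Cod M \<psi>"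
  using cat_functor.FA_in_hom[OF Act_functor, of "(f, \<psi>)" "(Dom C f, Dom M \<psi>)" "(Cod C f, Cod M \<psi>)"]
    assms by (auto simp: act_ob_def act_ar_def prod_cat_def hom_def)

lemma act_Idn [simp]:
  "\<lbrakk>x \<in> Obj C; m \<in> Obj M\<rbrakk> \<Longrightarrow> Idn C x \<odot>\<^bsub>M\<^esub> Idn M m = Idn M (x \<odot>\<^sub>o\<^bsub>M\<^esub> m)"
  using cat_functor.FA_Idn[OF Act_functor, of "(x, m)"]
  by (simp add: act_ob_def act_ar_def prod_cat_def)

lemma act_Cmp [simp]:
  assumes "f \<in> Arr C" "f' \<in> Arr C" "Dom C f' = Cod C f"
    "\<psi> \<in> Arr M" "\<psi>' \<in> Arr M" "Dom M \<psi>' = Cod M \<psi>"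
  shows "(f' \<odot>\<^bsub>M\<^esub> \<psi>') \<cdot>\<^bsub>M\<^esub> (f \<odot>\<^bsub>M\<^esub> \<psi>) = (f' \<cdot>\<^bsub>C\<^esub> f) \<odot>\<^bsub>M\<^esub> (\<psi>' \<cdot>\<^bsub>M\<^esub> \<psi>)"
  using cat_functor.FA_Cmp[OF Act_functor, of "(f, \<psi>)" "(Dom C f, Dom M \<psi>)" "(Cod C f, Cod M \<psi>)"
      "(f', \<psi>')" "(Cod C f', Cod M \<psi>')"] assms
  by (auto simp: act_ar_def prod_cat_def hom_def)

lemma act_Cmp_extend [simp]:
  assumes "f \<in> Arr C" "f' \<in> Arr C" "Dom C f' = Cod C f"
    "\<psi> \<in> Arr M" "\<psi>' \<in> Arr M" "Dom M \<psi>' = Cod M \<psi>"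
    "e \<in> Arr M" "Cod M e = Dom C f \<odot>\<^sub>o\<^bsub>M\<^esub> Dom M \<psi>"
  shows "(f' \<odot>\<^bsub>M\<^esub> \<psi>') \<cdot>\<^bsub>M\<^esub> ((f \<odot>\<^bsub>M\<^esub> \<psi>) \<cdot>\<^bsub>M\<^esub> e) = ((f' \<cdot>\<^bsub>C\<^esub> f) \<odot>\<^bsub>M\<^esub> (\<psi>' \<cdot>\<^bsub>M\<^esub> \<psi>)) \<cdot>\<^bsub>M\<^esub> e"
  using assms M.Cmp_assoc_arr[of e "f \<odot>\<^bsub>M\<^esub> \<psi>" "f' \<odot>\<^bsub>M\<^esub> \<psi>'"] by simp

lemma act_on_left_functor:
  assumes "x \<in> Obj C"
  shows "cat_functor M M (act_on_left C M x)"
  by unfold_locales (use assms in \<open>auto simp: act_on_left_def hom_def\<close>)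

lemma ActAssoc_arr [simp]:
  assumes "x \<in> Obj C" "y \<in> Obj C" "m \<in> Obj M"
  shows "ActAssoc M x y m \<in> Arr M" "Dom M (ActAssoc M x y m) = x \<odot>\<^sub>o\<^bsub>M\<^esub> (y \<odot>\<^sub>o\<^bsub>M\<^esub> m)"
    "Cod M (ActAssoc M x y m) = (x \<otimes>\<^sub>o\<^bsub>C\<^esub> y) \<odot>\<^sub>o\<^bsub>M\<^esub> m"
  using ActAssoc_iso[OF assms] by (auto simp: iso_def hom_def)

lemma ActAssoc_natural_arr [simp]:
  assumes "f \<in> Arr C" "g \<in> Arr C" "\<psi> \<in> Arr M" "Cod C f = x'" "Cod C g = y'" "Cod M \<psi> = m'"
  shows "ActAssoc M x' y' m' \<cdot>\<^bsub>M\<^esub> (f \<odot>\<^bsub>M\<^esub> (g \<odot>\<^bsub>M\<^esub> \<psi>)) =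
    ((f \<otimes>\<^bsub>C\<^esub> g) \<odot>\<^bsub>M\<^esub> \<psi>) \<cdot>\<^bsub>M\<^esub> ActAssoc M (Dom C f) (Dom C g) (Dom M \<psi>)"
  using ActAssoc_natural[of f "Dom C f" x' g "Dom C g" y' \<psi> "Dom M \<psi>" m'] assms
  by (simp add: hom_def)

lemma ActAssoc_natural_extend [simp]:
  assumes "f \<in> Arr C" "g \<in> Arr C" "\<psi> \<in> Arr M" "Cod C f = x'" "Cod C g = y'" "Cod M \<psi> = m'"
    "e \<in> Arr M" "Cod M e = Dom C f \<odot>\<^sub>o\<^bsub>M\<^esub> (Dom C g \<odot>\<^sub>o\<^bsub>M\<^esub> Dom M \<psi>)"
  shows "ActAssoc M x' y' m' \<cdot>\<^bsub>M\<^esub> ((f \<odot>\<^bsub>M\<^esub> (g \<odot>\<^bsub>M\<^esub> \<psi>)) \<cdot>\<^bsub>M\<^esub> e) =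
    ((f \<otimes>\<^bsub>C\<^esub> g) \<odot>\<^bsub>M\<^esub> \<psi>) \<cdot>\<^bsub>M\<^esub> (ActAssoc M (Dom C f) (Dom C g) (Dom M \<psi>) \<cdot>\<^bsub>M\<^esub> e)"
  using assms C.Dom_in_Obj C.Cod_in_Obj M.Dom_in_Obj M.Cod_in_Obj
  by (intro M.Cmp_eq_extend ActAssoc_natural_arr) auto

text \<open>
  The case \<open>f \<odot> (1 \<odot> 1)\<close> of naturality needs its own rule, because its left-hand side does not
  survive the normalisation of \<open>1 \<odot> 1\<close>.
\<close>

lemma ActAssoc_natural_Idn:
  assumes "f \<in> Arr C" "Cod C f = x'" "y \<in> Obj C" "m \<in> Obj M"
  shows "ActAssoc M x' y m \<cdot>\<^bsub>M\<^esub> (f \<odot>\<^bsub>M\<^esub> Idn M (y \<odot>\<^sub>o\<^bsub>M\<^esub> m)) =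
    ((f \<otimes>\<^bsub>C\<^esub> Idn C y) \<odot>\<^bsub>M\<^esub> Idn M m) \<cdot>\<^bsub>M\<^esub> ActAssoc M (Dom C f) y m"
  using ActAssoc_natural_arr[of f "Idn C y" "Idn M m" x' y m] assms by simp

lemma ActUnit_arr [simp]:
  assumes "m \<in> Obj M"
  shows "ActUnit M m \<in> Arr M" "Dom M (ActUnit M m) = Unit C \<odot>\<^sub>o\<^bsub>M\<^esub> m" "Cod M (ActUnit M m) = m"
  using ActUnit_iso[OF assms] by (auto simp: iso_def hom_def)

lemma act_unit_inv:
  assumes "m \<in> Obj M"
  shows "act_unit_inv C M m \<in> hom M m (Unit C \<odot>\<^sub>o\<^bsub>M\<^esub> m) \<and>
    act_unit_inv C M m \<cdot>\<^bsub>M\<^esub> ActUnit M m = Idn M (Unit C \<odot>\<^sub>o\<^bsub>M\<^esub> m) \<and>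
    ActUnit M m \<cdot>\<^bsub>M\<^esub> act_unit_inv C M m = Idn M m"
  unfolding act_unit_inv_def by (rule someI_ex) (use ActUnit_iso[OF assms] in \<open>auto simp: iso_def\<close>)

lemma act_unit_inv_arr [simp]:
  assumes "m \<in> Obj M"
  shows "act_unit_inv C M m \<in> Arr M" "Dom M (act_unit_inv C M m) = m"
    "Cod M (act_unit_inv C M m) = Unit C \<odot>\<^sub>o\<^bsub>M\<^esub> m"
    "act_unit_inv C M m \<cdot>\<^bsub>M\<^esub> ActUnit M m = Idn M (Unit C \<odot>\<^sub>o\<^bsub>M\<^esub> m)"
    "ActUnit M m \<cdot>\<^bsub>M\<^esub> act_unit_inv C M m = Idn M m"
  using act_unit_inv[OF assms] by (auto simp: hom_def)

lemma act_unit_inv_natural: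
  assumes "\<psi> \<in> Arr M"
  shows "(Idn C (Unit C) \<odot>\<^bsub>M\<^esub> \<psi>) \<cdot>\<^bsub>M\<^esub> act_unit_inv C M (Dom M \<psi>) = act_unit_inv C M (Cod M \<psi>) \<cdot>\<^bsub>M\<^esub> \<psi>"
proof -
  let ?m = "Dom M \<psi>" and ?n = "Cod M \<psi>"
  have [simp]: "?m \<in> Obj M" "?n \<in> Obj M" using assms M.Dom_in_Obj M.Cod_in_Obj by auto
  have nat: "ActUnit M ?n \<cdot>\<^bsub>M\<^esub> (Idn C (Unit C) \<odot>\<^bsub>M\<^esub> \<psi>) = \<psi> \<cdot>\<^bsub>M\<^esub> ActUnit M ?m"
    using ActUnit_natural[of \<psi> ?m ?n] assms by (simp add: hom_def)
  have "(Idn C (Unit C) \<odot>\<^bsub>M\<^esub> \<psi>) \<cdot>\<^bsub>M\<^esub> act_unit_inv C M ?m =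
      (act_unit_inv C M ?n \<cdot>\<^bsub>M\<^esub> ActUnit M ?n) \<cdot>\<^bsub>M\<^esub> ((Idn C (Unit C) \<odot>\<^bsub>M\<^esub> \<psi>) \<cdot>\<^bsub>M\<^esub> act_unit_inv C M ?m)"
    by (subst act_unit_inv_arr) (use assms in simp_all)
  also have "\<dots> = act_unit_inv C M ?n \<cdot>\<^bsub>M\<^esub> ((ActUnit M ?n \<cdot>\<^bsub>M\<^esub> (Idn C (Unit C) \<odot>\<^bsub>M\<^esub> \<psi>)) \<cdot>\<^bsub>M\<^esub> act_unit_inv C M ?m)"
    using assms by (simp del: act_unit_inv_arr(4))
  also have "\<dots> = act_unit_inv C M ?n \<cdot>\<^bsub>M\<^esub> \<psi>"
    unfolding nat using assms by simp
  finally show ?thesis .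
qed

end


section \<open>Categories of modules and restriction of scalars\<close>

locale monoid_in_actegory = actegory C M
  for C :: "('c, 'd, 'y) smcat_scheme" and M :: "('c, 'd, 'o, 'a, 'z) acteg_scheme" +
  fixes B :: "('c, 'd) mon"
  assumes monoid: "comm_monoid_ob C B"
begin

abbreviation b where "b \<equiv> Car B"

lemma monoid_arr [simp]:
  "b \<in> Obj C"
  "Mul B \<in> Arr C" "Dom C (Mul B) = b \<otimes>\<^sub>o\<^bsub>C\<^esub> b" "Cod C (Mul B) = b"
  "Uni B \<in> Arr C" "Dom C (Uni B) = Unit C" "Cod C (Uni B) = b"
  using monoid by (auto simp: comm_monoid_ob_def hom_def)

lemma monoid_laws:
  "Mul B \<cdot>\<^bsub>C\<^esub> (Mul B \<otimes>\<^bsub>C\<^esub> Idn C b) \<cdot>\<^bsub>C\<^esub> Assoc C b b b = Mul B \<cdot>\<^bsub>C\<^esub> (Idn C b \<otimes>\<^bsub>C\<^esub> Mul B)"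
  "Mul B \<cdot>\<^bsub>C\<^esub> (Uni B \<otimes>\<^bsub>C\<^esub> Idn C b) = LUnit C b"
  "Mul B \<cdot>\<^bsub>C\<^esub> (Idn C b \<otimes>\<^bsub>C\<^esub> Uni B) = RUnit C b"
  using monoid by (auto simp: comm_monoid_ob_def)

lemma module_obD:
  assumes "module_ob C M B (n, \<tau>)"
  shows "n \<in> Obj M" "\<tau> \<in> Arr M" "Dom M \<tau> = b \<odot>\<^sub>o\<^bsub>M\<^esub> n" "Cod M \<tau> = n"
    "\<tau> \<cdot>\<^bsub>M\<^esub> (Mul B \<odot>\<^bsub>M\<^esub> Idn M n) \<cdot>\<^bsub>M\<^esub> ActAssoc M b b n = \<tau> \<cdot>\<^bsub>M\<^esub> (Idn C b \<odot>\<^bsub>M\<^esub> \<tau>)"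
    "\<tau> \<cdot>\<^bsub>M\<^esub> (Uni B \<odot>\<^bsub>M\<^esub> Idn M n) = ActUnit M n"
  using assms by (auto simp: module_ob_def hom_def)

lemma module_morD:
  assumes "module_mor C M B (m, \<sigma>) (n, \<tau>) \<psi>"
  shows "\<psi> \<in> Arr M" "Dom M \<psi> = m" "Cod M \<psi> = n"
    "\<tau> \<cdot>\<^bsub>M\<^esub> (Idn C b \<odot>\<^bsub>M\<^esub> \<psi>) = \<psi> \<cdot>\<^bsub>M\<^esub> \<sigma>"
  using assms by (auto simp: module_mor_def hom_def)

lemma module_mor_Idn:
  assumes X: "module_ob C M B X"
  shows "module_mor C M B X X (Idn M (fst X))"
proof -
  obtain m \<sigma> where [simp]: "X = (m, \<sigma>)" by (cases X)
  show ?thesis using module_obD(1-4)[OF X[simplified]] by (simp add: module_mor_def hom_def)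
qed

lemma module_mor_Cmp:
  assumes X: "module_ob C M B X" and Y: "module_ob C M B Y" and Z: "module_ob C M B Z"
    and \<psi>: "module_mor C M B X Y \<psi>" and \<chi>: "module_mor C M B Y Z \<chi>"
  shows "module_mor C M B X Z (\<chi> \<cdot>\<^bsub>M\<^esub> \<psi>)"
proof -
  obtain m \<sigma> n \<tau> k \<upsilon> where [simp]: "X = (m, \<sigma>)" "Y = (n, \<tau>)" "Z = (k, \<upsilon>)"
    by (cases X, cases Y, cases Z) auto
  note [simp] = module_obD(1-4)[OF X[simplified]] module_obD(1-4)[OF Y[simplified]]
    module_obD(1-4)[OF Z[simplified]] module_morD(1-3)[OF \<psi>[simplified]] module_morD(1-3)[OF \<chi>[simplified]]
  have "\<upsilon> \<cdot>\<^bsub>M\<^esub> (Idn C b \<odot>\<^bsub>M\<^esub> (\<chi> \<cdot>\<^bsub>M\<^esub> \<psi>)) = (\<upsilon> \<cdot>\<^bsub>M\<^esub> (Idn C b \<odot>\<^bsub>M\<^esub> \<chi>)) \<cdot>\<^bsub>M\<^esub> (Idn C b \<odot>\<^bsub>M\<^esub> \<psi>)"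
    by simp
  also have "\<dots> = \<chi> \<cdot>\<^bsub>M\<^esub> (\<tau> \<cdot>\<^bsub>M\<^esub> (Idn C b \<odot>\<^bsub>M\<^esub> \<psi>))"
    unfolding module_morD(4)[OF \<chi>[simplified]] by simp
  also have "\<dots> = (\<chi> \<cdot>\<^bsub>M\<^esub> \<psi>) \<cdot>\<^bsub>M\<^esub> \<sigma>"
    unfolding module_morD(4)[OF \<psi>[simplified]] by simp
  finally show ?thesis by (simp add: module_mor_def hom_def)
qed

lemma hom_Mod:
  "hom (Mod C M B) X Y =
    (if module_ob C M B X \<and> module_ob C M B Y then (\<lambda>\<psi>. (X, \<psi>, Y)) ` {\<psi>. module_mor C M B X Y \<psi>} else {})"
  by (auto simp: hom_def Mod_def)

lemma category_Mod: "category (Mod C M B)"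
proof (rule category.intro)
  show "Idn (Mod C M B) X \<in> hom (Mod C M B) X X" if "X \<in> Obj (Mod C M B)" for X
    using that module_mor_Idn by (simp add: Mod_def hom_def)
  show "g \<cdot>\<^bsub>Mod C M B\<^esub> f \<in> hom (Mod C M B) X Z"
    if "f \<in> hom (Mod C M B) X Y" "g \<in> hom (Mod C M B) Y Z" for f g X Y Z
    using that module_mor_Cmp[of X Y Z] by (auto simp: Mod_def hom_def)
qed (auto simp: Mod_def hom_def module_mor_def)

end

locale monoid_morphism_in_actegory =
  monoid_in_actegory C M B + A: monoid_in_actegory C M A
  for C :: "('c, 'd, 'y) smcat_scheme" and M :: "('c, 'd, 'o, 'a, 'z) acteg_scheme"
    and A B :: "('c, 'd) mon" +
  fixes \<alpha> :: 'd
  assumes \<alpha>: "monoid_mor C A B \<alpha>"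
begin

abbreviation a where "a \<equiv> Car A"

lemma \<alpha>_arr [simp]: "\<alpha> \<in> Arr C" "Dom C \<alpha> = a" "Cod C \<alpha> = b"
  using \<alpha> by (auto simp: monoid_mor_def hom_def)

lemma restrict_module:
  assumes X: "module_ob C M B (n, \<tau>)"
  shows "module_ob C M A (restrict_ob M \<alpha> (n, \<tau>))"
proof -
  note [simp] = module_obD(1-4)[OF X]
  let ?\<rho> = "\<tau> \<cdot>\<^bsub>M\<^esub> (\<alpha> \<odot>\<^bsub>M\<^esub> Idn M n)"
  have "?\<rho> \<cdot>\<^bsub>M\<^esub> (Mul A \<odot>\<^bsub>M\<^esub> Idn M n) \<cdot>\<^bsub>M\<^esub> ActAssoc M a a n =
      \<tau> \<cdot>\<^bsub>M\<^esub> ((\<alpha> \<cdot>\<^bsub>C\<^esub> Mul A) \<odot>\<^bsub>M\<^esub> Idn M n) \<cdot>\<^bsub>M\<^esub> ActAssoc M a a n"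
    by simp
  also have "\<alpha> \<cdot>\<^bsub>C\<^esub> Mul A = Mul B \<cdot>\<^bsub>C\<^esub> (\<alpha> \<otimes>\<^bsub>C\<^esub> \<alpha>)"
    using \<alpha> by (simp add: monoid_mor_def)
  also have "\<tau> \<cdot>\<^bsub>M\<^esub> ((Mul B \<cdot>\<^bsub>C\<^esub> (\<alpha> \<otimes>\<^bsub>C\<^esub> \<alpha>)) \<odot>\<^bsub>M\<^esub> Idn M n) \<cdot>\<^bsub>M\<^esub> ActAssoc M a a n =
      (\<tau> \<cdot>\<^bsub>M\<^esub> (Mul B \<odot>\<^bsub>M\<^esub> Idn M n) \<cdot>\<^bsub>M\<^esub> ActAssoc M b b n) \<cdot>\<^bsub>M\<^esub> (\<alpha> \<odot>\<^bsub>M\<^esub> (\<alpha> \<odot>\<^bsub>M\<^esub> Idn M n))"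
    by simp
  also have "\<dots> = (\<tau> \<cdot>\<^bsub>M\<^esub> (Idn C b \<odot>\<^bsub>M\<^esub> \<tau>)) \<cdot>\<^bsub>M\<^esub> (\<alpha> \<odot>\<^bsub>M\<^esub> (\<alpha> \<odot>\<^bsub>M\<^esub> Idn M n))"
    unfolding module_obD(5)[OF X] ..
  also have "\<dots> = ?\<rho> \<cdot>\<^bsub>M\<^esub> (Idn C a \<odot>\<^bsub>M\<^esub> ?\<rho>)"
    by simp
  finally have assoc: "?\<rho> \<cdot>\<^bsub>M\<^esub> (Mul A \<odot>\<^bsub>M\<^esub> Idn M n) \<cdot>\<^bsub>M\<^esub> ActAssoc M a a n = ?\<rho> \<cdot>\<^bsub>M\<^esub> (Idn C a \<odot>\<^bsub>M\<^esub> ?\<rho>)" .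
  have "?\<rho> \<cdot>\<^bsub>M\<^esub> (Uni A \<odot>\<^bsub>M\<^esub> Idn M n) = ActUnit M n"
    using \<alpha> module_obD(6)[OF X] by (simp add: monoid_mor_def)
  with assoc show ?thesis by (simp add: restrict_ob_def module_ob_def hom_def)
qed

lemma restrict_module_mor:
  assumes X: "module_ob C M B (m, \<sigma>)" and Y: "module_ob C M B (n, \<tau>)"
    and \<psi>: "module_mor C M B (m, \<sigma>) (n, \<tau>) \<psi>"
  shows "module_mor C M A (restrict_ob M \<alpha> (m, \<sigma>)) (restrict_ob M \<alpha> (n, \<tau>)) \<psi>"
proof -
  note [simp] = module_obD(1-4)[OF X] module_obD(1-4)[OF Y] module_morD(1-3)[OF \<psi>]
  have "(\<tau> \<cdot>\<^bsub>M\<^esub> (\<alpha> \<odot>\<^bsub>M\<^esub> Idn M n)) \<cdot>\<^bsub>M\<^esub> (Idn C a \<odot>\<^bsub>M\<^esub> \<psi>) =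
      (\<tau> \<cdot>\<^bsub>M\<^esub> (Idn C b \<odot>\<^bsub>M\<^esub> \<psi>)) \<cdot>\<^bsub>M\<^esub> (\<alpha> \<odot>\<^bsub>M\<^esub> Idn M m)"
    by simp
  also have "\<dots> = \<psi> \<cdot>\<^bsub>M\<^esub> (\<sigma> \<cdot>\<^bsub>M\<^esub> (\<alpha> \<odot>\<^bsub>M\<^esub> Idn M m))"
    unfolding module_morD(4)[OF \<psi>] by simp
  finally show ?thesis by (simp add: restrict_ob_def module_mor_def hom_def)
qed

lemma restriction_functor: "cat_functor (Mod C M B) (Mod C M A) (restriction_of_scalars M \<alpha>)"
proof -
  interpret ModA: category "Mod C M A" by (rule A.category_Mod)
  interpret ModB: category "Mod C M B" by (rule category_Mod)
  show ?thesis
    by unfold_locales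
      (use restrict_module restrict_module_mor in
        \<open>auto simp: restriction_of_scalars_def hom_def Mod_def restrict_ob_def split: if_splits\<close>)
qed

end


section \<open>Free modules\<close>

text \<open>
  \<open>b \<odot> m\<close> with the action \<open>free_action\<close> is the free \<open>B\<close>-module on \<open>m\<close>, with \<open>free_unit\<close> as the
  insertion of generators: module morphisms from it to a module \<open>(n, \<tau>)\<close> correspond to arrows
  \<open>f : m \<rightarrow> n\<close> by \<open>f \<mapsto> \<tau> \<cdot> (b \<odot> f)\<close>.
\<close>

definition free_action :: "('c, 'd, 'o, 'a, 'z) acteg_scheme \<Rightarrow> ('c, 'd) mon \<Rightarrow> 'o \<Rightarrow> 'a" where
  "free_action M B m = (Mul B \<odot>\<^bsub>M\<^esub> Idn M m) \<cdot>\<^bsub>M\<^esub> ActAssoc M (Car B) (Car B) m"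

definition free_unit ::
  "('c, 'd, 'y) smcat_scheme \<Rightarrow> ('c, 'd, 'o, 'a, 'z) acteg_scheme \<Rightarrow> ('c, 'd) mon \<Rightarrow> 'o \<Rightarrow> 'a" where
  "free_unit C M B m = (Uni B \<odot>\<^bsub>M\<^esub> Idn M m) \<cdot>\<^bsub>M\<^esub> act_unit_inv C M m"

context monoid_in_actegory
begin

lemma free_action_arr [simp]:
  assumes "m \<in> Obj M"
  shows "free_action M B m \<in> Arr M" "Dom M (free_action M B m) = b \<odot>\<^sub>o\<^bsub>M\<^esub> (b \<odot>\<^sub>o\<^bsub>M\<^esub> m)"
    "Cod M (free_action M B m) = b \<odot>\<^sub>o\<^bsub>M\<^esub> m"
  using assms by (simp_all add: free_action_def)

lemma free_unit_arr [simp]: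
  assumes "m \<in> Obj M"
  shows "free_unit C M B m \<in> Arr M" "Dom M (free_unit C M B m) = m"
    "Cod M (free_unit C M B m) = b \<odot>\<^sub>o\<^bsub>M\<^esub> m"
  using assms by (simp_all add: free_unit_def)

lemma free_unit_natural:
  assumes "f \<in> Arr M"
  shows "(Idn C b \<odot>\<^bsub>M\<^esub> f) \<cdot>\<^bsub>M\<^esub> free_unit C M B (Dom M f) = free_unit C M B (Cod M f) \<cdot>\<^bsub>M\<^esub> f"
proof -
  have [simp]: "Dom M f \<in> Obj M" "Cod M f \<in> Obj M" using assms M.Dom_in_Obj M.Cod_in_Obj by auto
  have "(Idn C b \<odot>\<^bsub>M\<^esub> f) \<cdot>\<^bsub>M\<^esub> free_unit C M B (Dom M f) =
      (Uni B \<odot>\<^bsub>M\<^esub> Idn M (Cod M f)) \<cdot>\<^bsub>M\<^esub> ((Idn C (Unit C) \<odot>\<^bsub>M\<^esub> f) \<cdot>\<^bsub>M\<^esub> act_unit_inv C M (Dom M f))"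
    using assms by (simp add: free_unit_def)
  then show ?thesis
    unfolding act_unit_inv_natural[OF assms] using assms by (simp add: free_unit_def)
qed

text \<open>
  The unit law of a module says that the action retracts the insertion of generators.  This form
  contains no unit isomorphism on its right-hand side and passes easily along morphisms.
\<close>

lemma module_unit_iff:
  assumes "n \<in> Obj M" "\<tau> \<in> Arr M" "Dom M \<tau> = b \<odot>\<^sub>o\<^bsub>M\<^esub> n"
  shows "\<tau> \<cdot>\<^bsub>M\<^esub> (Uni B \<odot>\<^bsub>M\<^esub> Idn M n) = ActUnit M n \<longleftrightarrow> \<tau> \<cdot>\<^bsub>M\<^esub> free_unit C M B n = Idn M n"
proof
  assume unit: "\<tau> \<cdot>\<^bsub>M\<^esub> (Uni B \<odot>\<^bsub>M\<^esub> Idn M n) = ActUnit M n"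
  have "\<tau> \<cdot>\<^bsub>M\<^esub> free_unit C M B n = (\<tau> \<cdot>\<^bsub>M\<^esub> (Uni B \<odot>\<^bsub>M\<^esub> Idn M n)) \<cdot>\<^bsub>M\<^esub> act_unit_inv C M n"
    using assms by (simp add: free_unit_def)
  also have "\<dots> = Idn M n" unfolding unit using assms by simp
  finally show "\<tau> \<cdot>\<^bsub>M\<^esub> free_unit C M B n = Idn M n" .
next
  assume unit: "\<tau> \<cdot>\<^bsub>M\<^esub> free_unit C M B n = Idn M n"
  have "\<tau> \<cdot>\<^bsub>M\<^esub> (Uni B \<odot>\<^bsub>M\<^esub> Idn M n) = (\<tau> \<cdot>\<^bsub>M\<^esub> free_unit C M B n) \<cdot>\<^bsub>M\<^esub> ActUnit M n"
    using assms by (simp add: free_unit_def)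
  also have "\<dots> = ActUnit M n" unfolding unit using assms by (simp add: M.Cod_in_Obj)
  finally show "\<tau> \<cdot>\<^bsub>M\<^esub> (Uni B \<odot>\<^bsub>M\<^esub> Idn M n) = ActUnit M n" .
qed

text \<open>Associativity of the free action is the pentagon, its unit law the left unit triangle.\<close>

lemma free_module:
  assumes m: "m \<in> Obj M"
  shows "module_ob C M B (b \<odot>\<^sub>o\<^bsub>M\<^esub> m, free_action M B m)"
proof -
  note [simp] = m
  let ?\<gamma> = "free_action M B m"
  have "?\<gamma> \<cdot>\<^bsub>M\<^esub> (Mul B \<odot>\<^bsub>M\<^esub> Idn M (b \<odot>\<^sub>o\<^bsub>M\<^esub> m)) \<cdot>\<^bsub>M\<^esub> ActAssoc M b b (b \<odot>\<^sub>o\<^bsub>M\<^esub> m) =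
      (Mul B \<odot>\<^bsub>M\<^esub> Idn M m) \<cdot>\<^bsub>M\<^esub>
        (ActAssoc M b b m \<cdot>\<^bsub>M\<^esub> (Mul B \<odot>\<^bsub>M\<^esub> Idn M (b \<odot>\<^sub>o\<^bsub>M\<^esub> m))) \<cdot>\<^bsub>M\<^esub> ActAssoc M b b (b \<odot>\<^sub>o\<^bsub>M\<^esub> m)"
    by (simp add: free_action_def)
  also have "\<dots> = ((Mul B \<cdot>\<^bsub>C\<^esub> (Mul B \<otimes>\<^bsub>C\<^esub> Idn C b)) \<odot>\<^bsub>M\<^esub> Idn M m) \<cdot>\<^bsub>M\<^esub>
        (ActAssoc M (b \<otimes>\<^sub>o\<^bsub>C\<^esub> b) b m \<cdot>\<^bsub>M\<^esub> ActAssoc M b b (b \<odot>\<^sub>o\<^bsub>M\<^esub> m))"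
    by (subst ActAssoc_natural_Idn) simp_all
  also have "\<dots> = ((Mul B \<cdot>\<^bsub>C\<^esub> (Mul B \<otimes>\<^bsub>C\<^esub> Idn C b) \<cdot>\<^bsub>C\<^esub> Assoc C b b b) \<odot>\<^bsub>M\<^esub> Idn M m) \<cdot>\<^bsub>M\<^esub>
        ActAssoc M b (b \<otimes>\<^sub>o\<^bsub>C\<^esub> b) m \<cdot>\<^bsub>M\<^esub> (Idn C b \<odot>\<^bsub>M\<^esub> ActAssoc M b b m)"
    by (subst act_pentagon) simp_all
  also have "\<dots> = ((Mul B \<cdot>\<^bsub>C\<^esub> (Idn C b \<otimes>\<^bsub>C\<^esub> Mul B)) \<odot>\<^bsub>M\<^esub> Idn M m) \<cdot>\<^bsub>M\<^esub>
        ActAssoc M b (b \<otimes>\<^sub>o\<^bsub>C\<^esub> b) m \<cdot>\<^bsub>M\<^esub> (Idn C b \<odot>\<^bsub>M\<^esub> ActAssoc M b b m)"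
    unfolding monoid_laws(1) ..
  also have "\<dots> = ?\<gamma> \<cdot>\<^bsub>M\<^esub> ((Idn C b \<odot>\<^bsub>M\<^esub> (Mul B \<odot>\<^bsub>M\<^esub> Idn M m)) \<cdot>\<^bsub>M\<^esub> (Idn C b \<odot>\<^bsub>M\<^esub> ActAssoc M b b m))"
    by (simp add: free_action_def del: act_Cmp)
  also have "\<dots> = ?\<gamma> \<cdot>\<^bsub>M\<^esub> (Idn C b \<odot>\<^bsub>M\<^esub> ?\<gamma>)"
    by (simp add: free_action_def)
  finally have assoc: "?\<gamma> \<cdot>\<^bsub>M\<^esub> (Mul B \<odot>\<^bsub>M\<^esub> Idn M (b \<odot>\<^sub>o\<^bsub>M\<^esub> m)) \<cdot>\<^bsub>M\<^esub> ActAssoc M b b (b \<odot>\<^sub>o\<^bsub>M\<^esub> m) =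
      ?\<gamma> \<cdot>\<^bsub>M\<^esub> (Idn C b \<odot>\<^bsub>M\<^esub> ?\<gamma>)" .
  have "?\<gamma> \<cdot>\<^bsub>M\<^esub> (Uni B \<odot>\<^bsub>M\<^esub> Idn M (b \<odot>\<^sub>o\<^bsub>M\<^esub> m)) =
      (Mul B \<odot>\<^bsub>M\<^esub> Idn M m) \<cdot>\<^bsub>M\<^esub> (ActAssoc M b b m \<cdot>\<^bsub>M\<^esub> (Uni B \<odot>\<^bsub>M\<^esub> Idn M (b \<odot>\<^sub>o\<^bsub>M\<^esub> m)))"
    by (simp add: free_action_def)
  also have "\<dots> = ((Mul B \<cdot>\<^bsub>C\<^esub> (Uni B \<otimes>\<^bsub>C\<^esub> Idn C b)) \<odot>\<^bsub>M\<^esub> Idn M m) \<cdot>\<^bsub>M\<^esub> ActAssoc M (Unit C) b m"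
    by (subst ActAssoc_natural_Idn) simp_all
  also have "\<dots> = ActUnit M (b \<odot>\<^sub>o\<^bsub>M\<^esub> m)"
    unfolding monoid_laws(2) by (simp add: act_triangle_left)
  finally show ?thesis using assoc by (simp add: module_ob_def hom_def)
qed

lemma free_module_mor:
  assumes "f \<in> Arr M"
  shows "module_mor C M B (b \<odot>\<^sub>o\<^bsub>M\<^esub> Dom M f, free_action M B (Dom M f))
    (b \<odot>\<^sub>o\<^bsub>M\<^esub> Cod M f, free_action M B (Cod M f)) (Idn C b \<odot>\<^bsub>M\<^esub> f)"
  using assms M.Dom_in_Obj[of f] M.Cod_in_Obj[of f]
  by (simp add: module_mor_def hom_def free_action_def)

text \<open>\<open>B\<close>-linearity of the extension is associativity of the action of \<open>(n, \<tau>)\<close>.\<close>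

lemma free_extension_mor:
  assumes Y: "module_ob C M B (n, \<tau>)" and f: "f \<in> hom M m n"
  shows "module_mor C M B (b \<odot>\<^sub>o\<^bsub>M\<^esub> m, free_action M B m) (n, \<tau>) (\<tau> \<cdot>\<^bsub>M\<^esub> (Idn C b \<odot>\<^bsub>M\<^esub> f))"
proof -
  note [simp] = module_obD(1-4)[OF Y] M.in_homD[OF f]
  have "\<tau> \<cdot>\<^bsub>M\<^esub> (Idn C b \<odot>\<^bsub>M\<^esub> (\<tau> \<cdot>\<^bsub>M\<^esub> (Idn C b \<odot>\<^bsub>M\<^esub> f))) =
      (\<tau> \<cdot>\<^bsub>M\<^esub> (Idn C b \<odot>\<^bsub>M\<^esub> \<tau>)) \<cdot>\<^bsub>M\<^esub> (Idn C b \<odot>\<^bsub>M\<^esub> (Idn C b \<odot>\<^bsub>M\<^esub> f))"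
    by simp
  also have "\<dots> = (\<tau> \<cdot>\<^bsub>M\<^esub> (Idn C b \<odot>\<^bsub>M\<^esub> f)) \<cdot>\<^bsub>M\<^esub> free_action M B m"
    unfolding module_obD(5)[OF Y, symmetric] by (simp add: free_action_def)
  finally show ?thesis by (simp add: module_mor_def hom_def)
qed

lemma free_extension_unit:
  assumes Y: "module_ob C M B (n, \<tau>)" and f: "f \<in> hom M m n"
  shows "(\<tau> \<cdot>\<^bsub>M\<^esub> (Idn C b \<odot>\<^bsub>M\<^esub> f)) \<cdot>\<^bsub>M\<^esub> free_unit C M B m = f"
proof -
  note [simp] = module_obD(1-4)[OF Y] M.in_homD[OF f]
  have "(\<tau> \<cdot>\<^bsub>M\<^esub> (Idn C b \<odot>\<^bsub>M\<^esub> f)) \<cdot>\<^bsub>M\<^esub> free_unit C M B m =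
      \<tau> \<cdot>\<^bsub>M\<^esub> ((Idn C b \<odot>\<^bsub>M\<^esub> f) \<cdot>\<^bsub>M\<^esub> free_unit C M B (Dom M f))" by simp
  also have "\<dots> = (\<tau> \<cdot>\<^bsub>M\<^esub> free_unit C M B n) \<cdot>\<^bsub>M\<^esub> f"
    by (subst free_unit_natural) simp_all
  also have "\<tau> \<cdot>\<^bsub>M\<^esub> free_unit C M B n = Idn M n"
    using module_unit_iff[of n \<tau>] module_obD(6)[OF Y] by simp
  finally show ?thesis by simp
qed

text \<open>
  Multiplying generators \<open>1 \<odot> m\<close> by \<open>b\<close> yields all of \<open>b \<odot> m\<close>; this is the right unit law of
  the monoid, transported by the right unit triangle.  It makes linear arrows out of \<open>b \<odot> m\<close>
  determined by their restriction to generators.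
\<close>

lemma free_action_free_unit:
  assumes [simp]: "m \<in> Obj M"
  shows "free_action M B m \<cdot>\<^bsub>M\<^esub> (Idn C b \<odot>\<^bsub>M\<^esub> free_unit C M B m) = Idn M (b \<odot>\<^sub>o\<^bsub>M\<^esub> m)"
proof -
  have "free_action M B m \<cdot>\<^bsub>M\<^esub> (Idn C b \<odot>\<^bsub>M\<^esub> free_unit C M B m) =
      free_action M B m \<cdot>\<^bsub>M\<^esub> (Idn C b \<odot>\<^bsub>M\<^esub> (Uni B \<odot>\<^bsub>M\<^esub> Idn M m)) \<cdot>\<^bsub>M\<^esub> (Idn C b \<odot>\<^bsub>M\<^esub> act_unit_inv C M m)"
    by (simp add: free_unit_def)
  also have "\<dots> = ((Mul B \<cdot>\<^bsub>C\<^esub> (Idn C b \<otimes>\<^bsub>C\<^esub> Uni B)) \<odot>\<^bsub>M\<^esub> Idn M m) \<cdot>\<^bsub>M\<^esub>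
      ActAssoc M b (Unit C) m \<cdot>\<^bsub>M\<^esub> (Idn C b \<odot>\<^bsub>M\<^esub> act_unit_inv C M m)"
    by (simp add: free_action_def del: act_Cmp)
  also have "\<dots> = ((RUnit C b \<odot>\<^bsub>M\<^esub> Idn M m) \<cdot>\<^bsub>M\<^esub> ActAssoc M b (Unit C) m) \<cdot>\<^bsub>M\<^esub>
      (Idn C b \<odot>\<^bsub>M\<^esub> act_unit_inv C M m)"
    unfolding monoid_laws(3) by simp
  also have "\<dots> = Idn M (b \<odot>\<^sub>o\<^bsub>M\<^esub> m)"
    by (subst act_triangle) simp_all
  finally show ?thesis .
qed

lemma free_mor_eq_extension:
  assumes Y: "module_ob C M B (n, \<tau>)" and m: "m \<in> Obj M"
    and k: "module_mor C M B (b \<odot>\<^sub>o\<^bsub>M\<^esub> m, free_action M B m) (n, \<tau>) k"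
  shows "k = \<tau> \<cdot>\<^bsub>M\<^esub> (Idn C b \<odot>\<^bsub>M\<^esub> (k \<cdot>\<^bsub>M\<^esub> free_unit C M B m))"
proof -
  note [simp] = m module_obD(1-4)[OF Y] module_morD(1-3)[OF k]
  have "\<tau> \<cdot>\<^bsub>M\<^esub> (Idn C b \<odot>\<^bsub>M\<^esub> (k \<cdot>\<^bsub>M\<^esub> free_unit C M B m)) =
      (\<tau> \<cdot>\<^bsub>M\<^esub> (Idn C b \<odot>\<^bsub>M\<^esub> k)) \<cdot>\<^bsub>M\<^esub> (Idn C b \<odot>\<^bsub>M\<^esub> free_unit C M B m)"
    by simp
  also have "\<dots> = k"
    unfolding module_morD(4)[OF k] by (simp add: free_action_free_unit)
  finally show ?thesis by simp
qed

end


section \<open>Coequalizers of modules\<close>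

text \<open>
  If \<open>b \<odot> -\<close> preserves coequalizers, a coequalizer in \<open>M\<close> of two module morphisms is also one of
  modules: \<open>b \<odot> q\<close> being again a coequalizer, the action and its compatibility with other
  morphisms descend along it.
\<close>

locale right_exact_monoid = monoid_in_actegory +
  assumes preserves: "is_coequalizer M f g z q \<Longrightarrow>
    is_coequalizer M (Idn C b \<odot>\<^bsub>M\<^esub> f) (Idn C b \<odot>\<^bsub>M\<^esub> g) (b \<odot>\<^sub>o\<^bsub>M\<^esub> z) (Idn C b \<odot>\<^bsub>M\<^esub> q)"
begin

lemma coequalizer_action_exists:
  assumes X: "module_ob C M B (x, \<sigma>)" and Y: "module_ob C M B (y, \<tau>)"
    and f: "module_mor C M B (x, \<sigma>) (y, \<tau>) f" and g: "module_mor C M B (x, \<sigma>) (y, \<tau>) g"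
    and coeq: "is_coequalizer M f g z q"
  shows "\<exists>!r. r \<in> hom M (b \<odot>\<^sub>o\<^bsub>M\<^esub> z) z \<and> r \<cdot>\<^bsub>M\<^esub> (Idn C b \<odot>\<^bsub>M\<^esub> q) = q \<cdot>\<^bsub>M\<^esub> \<tau>"
proof -
  note [simp] = module_obD(1-4)[OF X] module_obD(1-4)[OF Y] module_morD(1-3)[OF f] module_morD(1-3)[OF g]
  have q: "q \<in> Arr M" "Dom M q = y" "Cod M q = z" "q \<cdot>\<^bsub>M\<^esub> f = q \<cdot>\<^bsub>M\<^esub> g"
    using coeq by (auto simp: is_coequalizer_def hom_def)
  note [simp] = q(1-3)
  have "(q \<cdot>\<^bsub>M\<^esub> \<tau>) \<cdot>\<^bsub>M\<^esub> (Idn C b \<odot>\<^bsub>M\<^esub> f) = (q \<cdot>\<^bsub>M\<^esub> f) \<cdot>\<^bsub>M\<^esub> \<sigma>"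
    by (simp add: module_morD(4)[OF f])
  also have "\<dots> = (q \<cdot>\<^bsub>M\<^esub> \<tau>) \<cdot>\<^bsub>M\<^esub> (Idn C b \<odot>\<^bsub>M\<^esub> g)"
    unfolding q(4) by (simp add: module_morD(4)[OF g])
  finally have "(q \<cdot>\<^bsub>M\<^esub> \<tau>) \<cdot>\<^bsub>M\<^esub> (Idn C b \<odot>\<^bsub>M\<^esub> f) = (q \<cdot>\<^bsub>M\<^esub> \<tau>) \<cdot>\<^bsub>M\<^esub> (Idn C b \<odot>\<^bsub>M\<^esub> g)" .
  then show ?thesis
    by (rule coequalizer_factor[OF preserves[OF coeq]]) (simp_all add: hom_def)
qed

text \<open>
  The laws of \<open>(z, r)\<close> are those of \<open>(y, \<tau>)\<close> after composition with an epimorphism: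
  \<open>b \<odot> (b \<odot> q)\<close> for associativity, \<open>q\<close> itself for the unit law.
\<close>

lemma coequalizer_module:
  assumes Y: "module_ob C M B (y, \<tau>)" and coeq: "is_coequalizer M f g z q"
    and q: "q \<in> hom M y z" and r: "r \<in> hom M (b \<odot>\<^sub>o\<^bsub>M\<^esub> z) z"
    and rq: "r \<cdot>\<^bsub>M\<^esub> (Idn C b \<odot>\<^bsub>M\<^esub> q) = q \<cdot>\<^bsub>M\<^esub> \<tau>"
  shows "module_ob C M B (z, r)"
proof -
  note [simp] = module_obD(1-4)[OF Y] M.in_homD[OF q] M.in_homD[OF r]
  have rq_extend: "r \<cdot>\<^bsub>M\<^esub> ((Idn C b \<odot>\<^bsub>M\<^esub> q) \<cdot>\<^bsub>M\<^esub> e) = q \<cdot>\<^bsub>M\<^esub> (\<tau> \<cdot>\<^bsub>M\<^esub> e)"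
    if "e \<in> Arr M" "Cod M e = b \<odot>\<^sub>o\<^bsub>M\<^esub> y" for e
    using rq that by (intro M.Cmp_eq_extend) auto
  have "(r \<cdot>\<^bsub>M\<^esub> (Mul B \<odot>\<^bsub>M\<^esub> Idn M z) \<cdot>\<^bsub>M\<^esub> ActAssoc M b b z) \<cdot>\<^bsub>M\<^esub> (Idn C b \<odot>\<^bsub>M\<^esub> (Idn C b \<odot>\<^bsub>M\<^esub> q)) =
      r \<cdot>\<^bsub>M\<^esub> ((Idn C b \<odot>\<^bsub>M\<^esub> q) \<cdot>\<^bsub>M\<^esub> ((Mul B \<odot>\<^bsub>M\<^esub> Idn M y) \<cdot>\<^bsub>M\<^esub> ActAssoc M b b y))"
    by simp
  also have "\<dots> = q \<cdot>\<^bsub>M\<^esub> (\<tau> \<cdot>\<^bsub>M\<^esub> (Idn C b \<odot>\<^bsub>M\<^esub> \<tau>))"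
    by (subst rq_extend) (simp_all add: module_obD(5)[OF Y])
  also have "\<dots> = r \<cdot>\<^bsub>M\<^esub> ((Idn C b \<odot>\<^bsub>M\<^esub> q) \<cdot>\<^bsub>M\<^esub> (Idn C b \<odot>\<^bsub>M\<^esub> \<tau>))"
    by (subst rq_extend) simp_all
  also have "\<dots> = r \<cdot>\<^bsub>M\<^esub> (Idn C b \<odot>\<^bsub>M\<^esub> (r \<cdot>\<^bsub>M\<^esub> (Idn C b \<odot>\<^bsub>M\<^esub> q)))"
    by (simp add: rq)
  also have "\<dots> = (r \<cdot>\<^bsub>M\<^esub> (Idn C b \<odot>\<^bsub>M\<^esub> r)) \<cdot>\<^bsub>M\<^esub> (Idn C b \<odot>\<^bsub>M\<^esub> (Idn C b \<odot>\<^bsub>M\<^esub> q))"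
    by simp
  finally have assoc: "r \<cdot>\<^bsub>M\<^esub> (Mul B \<odot>\<^bsub>M\<^esub> Idn M z) \<cdot>\<^bsub>M\<^esub> ActAssoc M b b z = r \<cdot>\<^bsub>M\<^esub> (Idn C b \<odot>\<^bsub>M\<^esub> r)"
    by (rule coequalizer_cancel[OF M.category_axioms preserves[OF preserves[OF coeq]]])
      (simp_all add: hom_def)
  have "(r \<cdot>\<^bsub>M\<^esub> free_unit C M B z) \<cdot>\<^bsub>M\<^esub> q = r \<cdot>\<^bsub>M\<^esub> ((Idn C b \<odot>\<^bsub>M\<^esub> q) \<cdot>\<^bsub>M\<^esub> free_unit C M B y)"
    using free_unit_natural[of q] by simp
  also have "\<dots> = q \<cdot>\<^bsub>M\<^esub> (\<tau> \<cdot>\<^bsub>M\<^esub> free_unit C M B y)"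
    by (subst rq_extend) simp_all
  also have "\<tau> \<cdot>\<^bsub>M\<^esub> free_unit C M B y = Idn M y"
    using module_unit_iff[of y \<tau>] module_obD(6)[OF Y] by simp
  finally have "(r \<cdot>\<^bsub>M\<^esub> free_unit C M B z) \<cdot>\<^bsub>M\<^esub> q = Idn M z \<cdot>\<^bsub>M\<^esub> q" by simp
  then have "r \<cdot>\<^bsub>M\<^esub> free_unit C M B z = Idn M z"
    by (rule coequalizer_cancel[OF M.category_axioms coeq]) (simp_all add: hom_def)
  then have "r \<cdot>\<^bsub>M\<^esub> (Uni B \<odot>\<^bsub>M\<^esub> Idn M z) = ActUnit M z"
    by (subst module_unit_iff) simp_all
  with assoc show ?thesis by (simp add: module_ob_def hom_def)
qed

lemma coequalizer_mor_descends:
  assumes Y: "module_ob C M B (y, \<tau>)" and N: "module_ob C M B (n, \<upsilon>)"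
    and coeq: "is_coequalizer M f g z q"
    and q: "q \<in> hom M y z" and r: "r \<in> hom M (b \<odot>\<^sub>o\<^bsub>M\<^esub> z) z"
    and rq: "r \<cdot>\<^bsub>M\<^esub> (Idn C b \<odot>\<^bsub>M\<^esub> q) = q \<cdot>\<^bsub>M\<^esub> \<tau>"
    and h: "h \<in> hom M z n" and hq: "module_mor C M B (y, \<tau>) (n, \<upsilon>) (h \<cdot>\<^bsub>M\<^esub> q)"
  shows "module_mor C M B (z, r) (n, \<upsilon>) h"
proof -
  note [simp] = module_obD(1-4)[OF Y] module_obD(1-4)[OF N] M.in_homD[OF q] M.in_homD[OF r] M.in_homD[OF h]
  have "(\<upsilon> \<cdot>\<^bsub>M\<^esub> (Idn C b \<odot>\<^bsub>M\<^esub> h)) \<cdot>\<^bsub>M\<^esub> (Idn C b \<odot>\<^bsub>M\<^esub> q) = (h \<cdot>\<^bsub>M\<^esub> q) \<cdot>\<^bsub>M\<^esub> \<tau>"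
    using module_morD(4)[OF hq] by simp
  also have "\<dots> = (h \<cdot>\<^bsub>M\<^esub> r) \<cdot>\<^bsub>M\<^esub> (Idn C b \<odot>\<^bsub>M\<^esub> q)"
    by (simp add: rq)
  finally have "\<upsilon> \<cdot>\<^bsub>M\<^esub> (Idn C b \<odot>\<^bsub>M\<^esub> h) = h \<cdot>\<^bsub>M\<^esub> r"
    by (rule coequalizer_cancel[OF M.category_axioms preserves[OF coeq]]) (simp_all add: hom_def)
  then show ?thesis by (simp add: module_mor_def hom_def)
qed

end


section \<open>Extension of scalars\<close>

context monoid_morphism_in_actegory
begin

lemma ext_pair2_eq:
  assumes "m \<in> Obj M"
  shows "ext_pair2 C M A B \<alpha> (m, \<rho>) = free_action M B m \<cdot>\<^bsub>M\<^esub> (Idn C b \<odot>\<^bsub>M\<^esub> (\<alpha> \<odot>\<^bsub>M\<^esub> Idn M m))"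
  using assms by (simp add: ext_pair2_def free_action_def)

text \<open>
  The parallel pair defining \<open>b \<odot>\<^sub>a m\<close> consists of morphisms of free modules; the second one
  extends \<open>\<alpha> \<odot> m : a \<odot> m \<rightarrow> b \<odot> m\<close>.
\<close>

lemma ext_pair_mor:
  assumes X: "module_ob C M A (m, \<rho>)"
  shows "module_mor C M B (b \<odot>\<^sub>o\<^bsub>M\<^esub> (a \<odot>\<^sub>o\<^bsub>M\<^esub> m), free_action M B (a \<odot>\<^sub>o\<^bsub>M\<^esub> m))
      (b \<odot>\<^sub>o\<^bsub>M\<^esub> m, free_action M B m) (ext_pair1 C M B (m, \<rho>))"
    and "module_mor C M B (b \<odot>\<^sub>o\<^bsub>M\<^esub> (a \<odot>\<^sub>o\<^bsub>M\<^esub> m), free_action M B (a \<odot>\<^sub>o\<^bsub>M\<^esub> m))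
      (b \<odot>\<^sub>o\<^bsub>M\<^esub> m, free_action M B m) (ext_pair2 C M A B \<alpha> (m, \<rho>))"
proof -
  note [simp] = A.module_obD(1-4)[OF X]
  show "module_mor C M B (b \<odot>\<^sub>o\<^bsub>M\<^esub> (a \<odot>\<^sub>o\<^bsub>M\<^esub> m), free_action M B (a \<odot>\<^sub>o\<^bsub>M\<^esub> m))
      (b \<odot>\<^sub>o\<^bsub>M\<^esub> m, free_action M B m) (ext_pair1 C M B (m, \<rho>))"
    using free_module_mor[of \<rho>] by (simp add: ext_pair1_def)
  show "module_mor C M B (b \<odot>\<^sub>o\<^bsub>M\<^esub> (a \<odot>\<^sub>o\<^bsub>M\<^esub> m), free_action M B (a \<odot>\<^sub>o\<^bsub>M\<^esub> m))
      (b \<odot>\<^sub>o\<^bsub>M\<^esub> m, free_action M B m) (ext_pair2 C M A B \<alpha> (m, \<rho>))"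
    unfolding ext_pair2_eq[OF A.module_obD(1)[OF X]]
    by (rule free_extension_mor[OF free_module]) (simp_all add: hom_def)
qed

text \<open>
  The heart of the adjunction.  Composed with the pair, the extension \<open>\<tau> \<cdot> (b \<odot> f)\<close> of \<open>f\<close> gives
  the extensions to \<open>b \<odot> (a \<odot> m)\<close> of the two sides of the \<open>A\<close>-linearity equation for
  \<open>f : (m, \<rho>) \<rightarrow> \<alpha>\<^sub>* (n, \<tau>)\<close>, and an arrow is determined by its extension.
\<close>

lemma extension_coequalizes_iff:
  assumes X: "module_ob C M A (m, \<rho>)" and Y: "module_ob C M B (n, \<tau>)" and f: "f \<in> hom M m n"
  shows "(\<tau> \<cdot>\<^bsub>M\<^esub> (Idn C b \<odot>\<^bsub>M\<^esub> f)) \<cdot>\<^bsub>M\<^esub> ext_pair1 C M B (m, \<rho>) =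
      (\<tau> \<cdot>\<^bsub>M\<^esub> (Idn C b \<odot>\<^bsub>M\<^esub> f)) \<cdot>\<^bsub>M\<^esub> ext_pair2 C M A B \<alpha> (m, \<rho>) \<longleftrightarrow>
    module_mor C M A (m, \<rho>) (restrict_ob M \<alpha> (n, \<tau>)) f" (is "?coeq \<longleftrightarrow> ?linear")
proof -
  note [simp] = A.module_obD(1-4)[OF X] module_obD(1-4)[OF Y] M.in_homD[OF f]
  let ?left = "f \<cdot>\<^bsub>M\<^esub> \<rho>" and ?right = "\<tau> \<cdot>\<^bsub>M\<^esub> (\<alpha> \<odot>\<^bsub>M\<^esub> f)"
  have hom: "?left \<in> hom M (a \<odot>\<^sub>o\<^bsub>M\<^esub> m) n" "?right \<in> hom M (a \<odot>\<^sub>o\<^bsub>M\<^esub> m) n"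
    by (simp_all add: hom_def)
  have left: "(\<tau> \<cdot>\<^bsub>M\<^esub> (Idn C b \<odot>\<^bsub>M\<^esub> f)) \<cdot>\<^bsub>M\<^esub> ext_pair1 C M B (m, \<rho>) = \<tau> \<cdot>\<^bsub>M\<^esub> (Idn C b \<odot>\<^bsub>M\<^esub> ?left)"
    by (simp add: ext_pair1_def)
  have "(\<tau> \<cdot>\<^bsub>M\<^esub> (Idn C b \<odot>\<^bsub>M\<^esub> f)) \<cdot>\<^bsub>M\<^esub> ext_pair2 C M A B \<alpha> (m, \<rho>) =
      ((\<tau> \<cdot>\<^bsub>M\<^esub> (Idn C b \<odot>\<^bsub>M\<^esub> f)) \<cdot>\<^bsub>M\<^esub> free_action M B m) \<cdot>\<^bsub>M\<^esub> (Idn C b \<odot>\<^bsub>M\<^esub> (\<alpha> \<odot>\<^bsub>M\<^esub> Idn M m))"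
    by (simp add: ext_pair2_eq)
  also have "\<dots> = \<tau> \<cdot>\<^bsub>M\<^esub> (Idn C b \<odot>\<^bsub>M\<^esub> ?right)"
    unfolding module_morD(4)[OF free_extension_mor[OF Y f], symmetric] by simp
  finally have right: "(\<tau> \<cdot>\<^bsub>M\<^esub> (Idn C b \<odot>\<^bsub>M\<^esub> f)) \<cdot>\<^bsub>M\<^esub> ext_pair2 C M A B \<alpha> (m, \<rho>) =
    \<tau> \<cdot>\<^bsub>M\<^esub> (Idn C b \<odot>\<^bsub>M\<^esub> ?right)" .
  have "?coeq \<longleftrightarrow> ?left = ?right"
    unfolding left right using free_extension_unit[OF Y hom(1)] free_extension_unit[OF Y hom(2)] by metis
  also have "\<dots> \<longleftrightarrow> ?linear"
    by (auto simp: module_mor_def restrict_ob_def hom_def)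
  finally show ?thesis .
qed

end

locale right_exact_monoid_morphism =
  monoid_morphism_in_actegory C M A B \<alpha> + right_exact_monoid C M B
  for C :: "('c, 'd, 'y) smcat_scheme" and M :: "('c, 'd, 'o, 'a, 'z) acteg_scheme"
    and A B :: "('c, 'd) mon" and \<alpha> :: 'd
begin

text \<open>
  Module morphisms out of \<open>b \<odot>\<^sub>a m\<close> are module morphisms out of the free module \<open>b \<odot> m\<close> that
  coequalize the pair, hence extensions of \<open>A\<close>-linear arrows out of \<open>m\<close>.  The universal arrow
  corresponds to the identity of \<open>b \<odot>\<^sub>a m\<close>, that is, it is the arrow with extension \<open>q\<close>.
\<close>

lemma extension_universal:
  assumes X: "module_ob C M A (m, \<rho>)"
    and coeq: "is_coequalizer M (ext_pair1 C M B (m, \<rho>)) (ext_pair2 C M A B \<alpha> (m, \<rho>)) z q"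
  defines "r \<equiv> ext_action C M B m z q"
    and "\<eta> \<equiv> q \<cdot>\<^bsub>M\<^esub> free_unit C M B m"
  shows "module_ob C M B (z, r)"
    and "module_mor C M A (m, \<rho>) (restrict_ob M \<alpha> (z, r)) \<eta>"
    and "\<lbrakk>module_ob C M B (n, \<tau>); module_mor C M A (m, \<rho>) (restrict_ob M \<alpha> (n, \<tau>)) f\<rbrakk>
      \<Longrightarrow> \<exists>!h. module_mor C M B (z, r) (n, \<tau>) h \<and> h \<cdot>\<^bsub>M\<^esub> \<eta> = f"
proof -
  note [simp] = A.module_obD(1-4)[OF X]
  note free = free_module[OF A.module_obD(1)[OF X]]
  have Cod_pair: "Cod M (ext_pair1 C M B (m, \<rho>)) = b \<odot>\<^sub>o\<^bsub>M\<^esub> m"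
    by (simp add: ext_pair1_def)
  then have q: "q \<in> hom M (b \<odot>\<^sub>o\<^bsub>M\<^esub> m) z"
    and q_eq: "q \<cdot>\<^bsub>M\<^esub> ext_pair1 C M B (m, \<rho>) = q \<cdot>\<^bsub>M\<^esub> ext_pair2 C M A B \<alpha> (m, \<rho>)"
    using coeq unfolding is_coequalizer_def Cod_pair by blast+
  note [simp] = M.in_homD[OF q]
  have "\<exists>!r. r \<in> hom M (b \<odot>\<^sub>o\<^bsub>M\<^esub> z) z \<and> r \<cdot>\<^bsub>M\<^esub> (Idn C b \<odot>\<^bsub>M\<^esub> q) = q \<cdot>\<^bsub>M\<^esub> free_action M B m"
    by (rule coequalizer_action_exists[OF free_module free ext_pair_mor[OF X] coeq]) simp
  from theI'[OF this] have r: "r \<in> hom M (b \<odot>\<^sub>o\<^bsub>M\<^esub> z) z"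
    and rq: "r \<cdot>\<^bsub>M\<^esub> (Idn C b \<odot>\<^bsub>M\<^esub> q) = q \<cdot>\<^bsub>M\<^esub> free_action M B m"
    by (simp_all add: r_def ext_action_def free_action_def)
  show Z: "module_ob C M B (z, r)"
    by (rule coequalizer_module[OF free coeq q r rq])
  have q_mor: "module_mor C M B (b \<odot>\<^sub>o\<^bsub>M\<^esub> m, free_action M B m) (z, r) q"
    using rq q by (simp add: module_mor_def)
  have \<eta>: "\<eta> \<in> hom M m z"
    by (simp add: \<eta>_def hom_def)
  note [simp] = M.in_homD[OF r] M.in_homD[OF \<eta>]
  \<comment> \<open>\<open>q\<close> coequalizes the pair, so \<open>\<eta>\<close>, whose extension it is, must be \<open>A\<close>-linear.\<close>
  have q_extends: "q = r \<cdot>\<^bsub>M\<^esub> (Idn C b \<odot>\<^bsub>M\<^esub> \<eta>)"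
    unfolding \<eta>_def by (rule free_mor_eq_extension[OF Z _ q_mor]) simp
  then show "module_mor C M A (m, \<rho>) (restrict_ob M \<alpha> (z, r)) \<eta>"
    using extension_coequalizes_iff[OF X Z \<eta>] q_eq by simp
  assume Y: "module_ob C M B (n, \<tau>)" and f_mor: "module_mor C M A (m, \<rho>) (restrict_ob M \<alpha> (n, \<tau>)) f"
  have f: "f \<in> hom M m n"
    using f_mor by (simp add: module_mor_def restrict_ob_def)
  note [simp] = module_obD(1-4)[OF Y] M.in_homD[OF f]
  let ?k = "\<tau> \<cdot>\<^bsub>M\<^esub> (Idn C b \<odot>\<^bsub>M\<^esub> f)"
  have "?k \<cdot>\<^bsub>M\<^esub> ext_pair1 C M B (m, \<rho>) = ?k \<cdot>\<^bsub>M\<^esub> ext_pair2 C M A B \<alpha> (m, \<rho>)"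
    using extension_coequalizes_iff[OF X Y f] f_mor by simp
  then have "\<exists>!h. h \<in> hom M z n \<and> h \<cdot>\<^bsub>M\<^esub> q = ?k"
    by (rule coequalizer_factor[OF coeq]) (simp add: hom_def Cod_pair)
  then obtain h where h: "h \<in> hom M z n" "h \<cdot>\<^bsub>M\<^esub> q = ?k" by blast
  show "\<exists>!h. module_mor C M B (z, r) (n, \<tau>) h \<and> h \<cdot>\<^bsub>M\<^esub> \<eta> = f"
  proof (intro ex1I[of _ h] conjI)
    show "module_mor C M B (z, r) (n, \<tau>) h"
      using coequalizer_mor_descends[OF free Y coeq q r rq h(1)] free_extension_mor[OF Y f] h(2) by simp
    show "h \<cdot>\<^bsub>M\<^esub> \<eta> = f"
      using free_extension_unit[OF Y f] h M.in_homD[OF h(1)]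
        M.Cmp_assoc_arr[of "free_unit C M B m" q h] by (simp add: \<eta>_def)
  next
    fix h' assume h': "module_mor C M B (z, r) (n, \<tau>) h' \<and> h' \<cdot>\<^bsub>M\<^esub> \<eta> = f"
    note [simp] = module_morD(1-3)[OF conjunct1[OF h']]
    have "h' \<cdot>\<^bsub>M\<^esub> q = (h' \<cdot>\<^bsub>M\<^esub> r) \<cdot>\<^bsub>M\<^esub> (Idn C b \<odot>\<^bsub>M\<^esub> \<eta>)"
      by (subst q_extends) simp
    also have "\<dots> = \<tau> \<cdot>\<^bsub>M\<^esub> (Idn C b \<odot>\<^bsub>M\<^esub> (h' \<cdot>\<^bsub>M\<^esub> \<eta>))"
      unfolding module_morD(4)[OF conjunct1[OF h'], symmetric] by simp
    also have "\<dots> = h \<cdot>\<^bsub>M\<^esub> q"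
      using h' h(2) by simp
    finally show "h' = h"
      by (rule coequalizer_cancel[OF M.category_axioms coeq]) (use h(1) in \<open>simp_all add: hom_def\<close>)
  qed
qed

lemma extension_adjoint:
  assumes "ext_choice C M A B \<alpha> Q coeq"
  shows "\<exists>F. FO F = (\<lambda>(m, \<rho>). (Q (m, \<rho>), ext_action C M B m (Q (m, \<rho>)) (coeq (m, \<rho>)))) \<and>
    adjoint (Mod C M A) (Mod C M B) F (restriction_of_scalars M \<alpha>)"
proof (rule adjoint_of_universal_arrows[where
      \<eta> = "\<lambda>(m, \<rho>). ((m, \<rho>), coeq (m, \<rho>) \<cdot>\<^bsub>M\<^esub> free_unit C M B m,
        restrict_ob M \<alpha> (Q (m, \<rho>), ext_action C M B m (Q (m, \<rho>)) (coeq (m, \<rho>))))"])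
  let ?F0 = "\<lambda>(m, \<rho>). (Q (m, \<rho>), ext_action C M B m (Q (m, \<rho>)) (coeq (m, \<rho>)))"
  let ?\<eta> = "\<lambda>(m, \<rho>). ((m, \<rho>), coeq (m, \<rho>) \<cdot>\<^bsub>M\<^esub> free_unit C M B m,
        restrict_ob M \<alpha> (Q (m, \<rho>), ext_action C M B m (Q (m, \<rho>)) (coeq (m, \<rho>))))"
  have coeq: "is_coequalizer M (ext_pair1 C M B (m, \<rho>)) (ext_pair2 C M A B \<alpha> (m, \<rho>))
      (Q (m, \<rho>)) (coeq (m, \<rho>))" if "module_ob C M A (m, \<rho>)" for m \<rho>
    using assms that by (auto simp: ext_choice_def Mod_def)
  note universal = extension_universal[OF _ coeq]
  show "cat_functor (Mod C M B) (Mod C M A) (restriction_of_scalars M \<alpha>)"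
    by (rule restriction_functor)
  fix X assume "X \<in> Obj (Mod C M A)"
  then obtain m \<rho> where X: "X = (m, \<rho>)" "module_ob C M A (m, \<rho>)"
    by (cases X) (auto simp: Mod_def)
  show "?F0 X \<in> Obj (Mod C M B)"
    using universal(1) X by (simp add: Mod_def)
  show "?\<eta> X \<in> hom (Mod C M A) X (FO (restriction_of_scalars M \<alpha>) (?F0 X))"
    using universal(1,2) X restrict_module by (simp add: A.hom_Mod restriction_of_scalars_def)
  fix Y f assume "Y \<in> Obj (Mod C M B)" and f: "f \<in> hom (Mod C M A) X (FO (restriction_of_scalars M \<alpha>) Y)"
  then obtain n \<tau> where Y: "Y = (n, \<tau>)" "module_ob C M B (n, \<tau>)"
    by (cases Y) (auto simp: Mod_def)
  obtain \<psi> where \<psi>: "f = (X, \<psi>, restrict_ob M \<alpha> Y)" "module_mor C M A (m, \<rho>) (restrict_ob M \<alpha> (n, \<tau>)) \<psi>"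
    using f X Y by (auto simp: A.hom_Mod restriction_of_scalars_def split: if_splits)
  let ?q = "coeq (m, \<rho>) \<cdot>\<^bsub>M\<^esub> free_unit C M B m"
  have hom: "g \<in> hom (Mod C M B) (?F0 X) Y \<longleftrightarrow>
      (\<exists>h. g = (?F0 X, h, Y) \<and> module_mor C M B (?F0 X) Y h)" for g
    using universal(1)[OF X(2) X(2)] X(1) Y by (auto simp: hom_Mod)
  have eq: "FA (restriction_of_scalars M \<alpha>) (?F0 X, h, Y) \<cdot>\<^bsub>Mod C M A\<^esub> ?\<eta> X = f \<longleftrightarrow>
      h \<cdot>\<^bsub>M\<^esub> ?q = \<psi>" for h
    using X(1) \<psi>(1) by (simp add: restriction_of_scalars_def Mod_def)
  have "\<exists>!h. module_mor C M B (?F0 X) Y h \<and> h \<cdot>\<^bsub>M\<^esub> ?q = \<psi>"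
    using universal(3)[OF X(2) X(2) Y(2) \<psi>(2)] X(1) Y(1) by simp
  then obtain h where h: "module_mor C M B (?F0 X) Y h" "h \<cdot>\<^bsub>M\<^esub> ?q = \<psi>"
    and unique: "\<And>h'. \<lbrakk>module_mor C M B (?F0 X) Y h'; h' \<cdot>\<^bsub>M\<^esub> ?q = \<psi>\<rbrakk> \<Longrightarrow> h' = h"
    by blast
  show "\<exists>!g. g \<in> hom (Mod C M B) (?F0 X) Y \<and> FA (restriction_of_scalars M \<alpha>) g \<cdot>\<^bsub>Mod C M A\<^esub> ?\<eta> X = f"
  proof (intro ex1I[of _ "(?F0 X, h, Y)"] conjI)
    show "(?F0 X, h, Y) \<in> hom (Mod C M B) (?F0 X) Y" using hom h(1) by blast
    show "FA (restriction_of_scalars M \<alpha>) (?F0 X, h, Y) \<cdot>\<^bsub>Mod C M A\<^esub> ?\<eta> X = f" using eq h(2) by blast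
  next
    fix g
    assume g: "g \<in> hom (Mod C M B) (?F0 X) Y \<and> FA (restriction_of_scalars M \<alpha>) g \<cdot>\<^bsub>Mod C M A\<^esub> ?\<eta> X = f"
    then obtain h' where h': "g = (?F0 X, h', Y)" "module_mor C M B (?F0 X) Y h'"
      using hom by blast
    with g eq have "h' \<cdot>\<^bsub>M\<^esub> ?q = \<psi>" by blast
    with h' unique show "g = (?F0 X, h, Y)" by blast
  qed
qed

end

section \<open>The adjunction\<close>

theorem theorem2p4:
  fixes C :: "('c, 'd) smcat"
    and M :: "('c, 'd, 'o, 'a) acteg"
    and A B :: "('c, 'd) mon"
    and \<alpha> :: 'd
  assumes "infinite (UNIV :: 'u set)"
    and "closed_symmetric_monoidal_category C"
    and "complete_cat TYPE('u) C" and "cocomplete_cat TYPE('u) C"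
    and "actegory C M"
    and "complete_cat TYPE('u) M" and "cocomplete_cat TYPE('u) M"
    and "\<And>x. x \<in> Obj C \<Longrightarrow> preserves_colimits TYPE('u) M M (act_on_left C M x)"
    and "\<And>m. m \<in> Obj M \<Longrightarrow> preserves_colimits TYPE('u) C M (act_on_right M m)"
    and "(A, \<alpha>, B) \<in> hom (Comm C) A B"
  shows "(\<exists>Q coeq. ext_choice C M A B \<alpha> Q coeq) \<and>
    (\<forall>Q coeq. ext_choice C M A B \<alpha> Q coeq \<longrightarrow>
      (\<exists>F. (\<forall>(m, \<rho>) \<in> Obj (Mod C M A).
              FO F (m, \<rho>) = (Q (m, \<rho>), ext_action C M B m (Q (m, \<rho>)) (coeq (m, \<rho>)))) \<and>
           adjoint (Mod C M A) (Mod C M B) F (restriction_of_scalars M \<alpha>)))"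
proof -
  interpret actegory C M by fact
  have mon: "comm_monoid_ob C A" "comm_monoid_ob C B" "monoid_mor C A B \<alpha>"
    using assms(10) by (auto simp: Comm_def hom_def)
  have "Car B \<in> Obj C" using mon by (simp add: comm_monoid_ob_def)
  then have "is_coequalizer M (Idn C (Car B) \<odot>\<^bsub>M\<^esub> f) (Idn C (Car B) \<odot>\<^bsub>M\<^esub> g)
      (Car B \<odot>\<^sub>o\<^bsub>M\<^esub> z) (Idn C (Car B) \<odot>\<^bsub>M\<^esub> q)" if "is_coequalizer M f g z q" for f g z q
    using preserves_coequalizers[OF assms(1) act_on_left_functor assms(8) that]
    by (simp add: act_on_left_def)
  then interpret right_exact_monoid_morphism C M A B \<alpha>
    using mon by unfold_locales
  have "\<exists>z q. is_coequalizer M (ext_pair1 C M B X) (ext_pair2 C M A B \<alpha> X) z q"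
    if X_ob: "X \<in> Obj (Mod C M A)" for X
  proof -
    obtain m \<rho> where X: "X = (m, \<rho>)" "module_ob C M A (m, \<rho>)"
      using X_ob by (cases X) (auto simp: Mod_def)
    show ?thesis
      unfolding X(1)
      by (rule coequalizer_exists[OF assms(1) M.category_axioms assms(7)])
        (simp_all add: module_morD[OF ext_pair_mor(1)[OF X(2)]] module_morD[OF ext_pair_mor(2)[OF X(2)]])
  qed
  then have "\<exists>Q coeq. ext_choice C M A B \<alpha> Q coeq"
    unfolding ext_choice_def by metis
  moreover have "\<exists>F. (\<forall>(m, \<rho>) \<in> Obj (Mod C M A).
        FO F (m, \<rho>) = (Q (m, \<rho>), ext_action C M B m (Q (m, \<rho>)) (coeq (m, \<rho>)))) \<and>
      adjoint (Mod C M A) (Mod C M B) F (restriction_of_scalars M \<alpha>)"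
    if "ext_choice C M A B \<alpha> Q coeq" for Q coeq
    using extension_adjoint[OF that] by force
  ultimately show ?thesis by blast
qed

end
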